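(* Fix an integer $m\ge 1$. Let $x$ be a complex random variable with $\mathbf{E}\,x=0$, $\mathbf{E}|x|^2=1$, $\mathbf{E}|x|^4<\infty$, and let $x_{ij}$, $i,j\in\{1,2,\dots\}$, be independent copies of $x$. Let $\mathbf{X}=(N^{-1/2}x_{ij})_{1\le i,j\le N}$, let $\lambda_1,\dots,\lambda_N$ be the eigenvalues of $\mathbf{X}^m(\mathbf{X}^* )^m$, and let $F_N^{(m)}(x)=N^{-1}\sum_{k=1}^N\mathbb{I}\{\lambda_k\le x\}$. Then the limit $\lim_{N\to\infty}\mathbf{E}\,F_N^{(m)}(x)$ exists and is equal to $G^{(m)}(x)$.
   Context: $\mathbf{X}^*$ is the adjoint (conjugate transpose) of $\mathbf{X}$; $\mathbb{I}\{A\}$ is the indicator function of the event $A$; eigenvalues are counted with multiplicity. $G^{(m)}$ denotes the distribution function of the (unique) probability measure on $\mathbb{R}$ whose $p$-th moment is the Fuss--Catalan number $M_p^{(m)}=\frac{1}{mp+1}\binom{mp+p}{p}$ for every $p=0,1,2,\dots$; this measure exists, and is uniquely determined by its moments. *)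

theory Defs
  imports "HOL-Probability.Probability"
    "Jordan_Normal_Form.Char_Poly" "Jordan_Normal_Form.Schur_Decomposition"
begin

definition fuss_catalan :: "nat \<Rightarrow> nat \<Rightarrow> real" where
  "fuss_catalan m p = real ((m * p + p) choose p) / real (m * p + 1)"

definition has_fuss_catalan_moments :: "nat \<Rightarrow> real measure \<Rightarrow> bool" where
  "has_fuss_catalan_moments m \<mu> \<longleftrightarrow>
     (\<forall>p. has_bochner_integral \<mu> (\<lambda>x. x ^ p) (fuss_catalan m p))"

text \<open>\<^const>\<open>real_distribution\<close> fixes the sigma-algebra to be the Borel one, without which
  a measure could not be determined by its moments.\<close>

definition fuss_catalan_measure :: "nat \<Rightarrow> real measure" where
  "fuss_catalan_measure m = (THE \<mu>. real_distribution \<mu> \<and> has_fuss_catalan_moments m \<mu>)"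

definition fuss_catalan_cdf :: "nat \<Rightarrow> real \<Rightarrow> real" where
  "fuss_catalan_cdf m = cdf (fuss_catalan_measure m)"

text \<open>The eigenvalues with multiplicity are the roots of the characteristic polynomial, as a
  multiset of complex numbers. They are real for the Hermitian matrices this is applied to,
  so that \<open>Re\<close> only performs the coercion to the reals.\<close>

definition eigenvalue_cdf :: "complex mat \<Rightarrow> real \<Rightarrow> real" where
  "eigenvalue_cdf A t =
     (\<Sum>z\<in>#proots (char_poly A). of_bool (Re z \<le> t)) / real (dim_row A)"

text \<open>Matrices have row and column indices \<open>0, \<dots>, N - 1\<close>, whereas the entries \<open>x i j\<close> are
  indexed from 1.\<close>

definition scaled_matrix :: "(nat \<Rightarrow> nat \<Rightarrow> complex) \<Rightarrow> nat \<Rightarrow> complex mat" where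
  "scaled_matrix x N =
     Matrix.mat N N (\<lambda>(i, j). complex_of_real (real N powr (-1/2)) * x (Suc i) (Suc j))"

definition power_product_cdf :: "nat \<Rightarrow> complex mat \<Rightarrow> real \<Rightarrow> real" where
  "power_product_cdf m X = eigenvalue_cdf (X ^\<^sub>m m * mat_adjoint X ^\<^sub>m m)"

end

theory Submission
  imports Defs
begin

text \<open>The proof is by the method of moments. A finite fourth moment makes it harmless to truncate
  the entries at \<open>sqrt N\<close>: with probability tending to one nothing changes. After scaling, the
  truncated entries \<open>Y\<close> satisfy \<open>E |Y|^2 = (1 + o(1)) / N\<close>, while every moment
  \<open>E (Y^a * cnj Y^b)\<close> with \<open>a + b \<noteq> 2\<close>, including the mean, is \<open>O(N powr (-3/2))\<close>; so no
  centering is needed. The expected trace of a word in \<open>X\<close> and its adjoint is a sum over closed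
  walks, and a walk with \<open>v\<close> vertices contributes \<open>O(N powr (1/2 - v))\<close>, unless it explores a tree
  and traverses every edge exactly once in each direction. Such tree walks are runs of a stack
  automaton, that is, noncrossing pairings of the letters \<open>X\<close> with letters \<open>X\<^sup>*\<close>. For the word
  \<open>(X\<^sup>m X\<^sup>*\<^sup>m)\<^sup>p\<close> their number is the Fuss--Catalan number, by a first-passage decomposition and the
  Raney numbers.

  The limit measure is realised as the law of a scaled product of independent beta variables. It
  is compactly supported, hence determined by its moments, and has no atoms, so that the
  distribution functions converge at every point.\<close>

section \<open>Raney numbers and noncrossing pairings\<close>

text \<open>The obstacle is that \<open>E x^2\<close> is arbitrary: an entry used twice by the same
  letter has a moment of order 1/N, just like \<open>E |x|^2\<close>. Counting edges as matrix
  positions settles this. An X step from i to k reads the entry (i, k) and an adjoint step from k to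
  i reads its conjugate, whereas an X step from k to i reads the independent entry (k, i). So in a
  tree, where every edge must be undone, the two uses carry opposite letters, and
  \<open>E x^2\<close> occurs only in walks that are negligible anyway.

  The truncation level is dictated by the fourth moment: the probabilities that the N^2 entries
  exceed sqrt N add up to o(1), while the scaled entries are at most 1, so that all high powers
  reduce to the cube. There are about N^v choices of v vertices; with the exponent 1/2 - v a sum of
  order sqrt N remains, and dividing by N leaves an error of order 1 / sqrt N.

  Only expected traces enter. The matrices have no uniform norm bound, so the polynomials must bound
  the indicator on the whole line; bounded support is used for the limit measure alone.\<close>

text \<open>\<open>raney m k r\<close> is the coefficient of \<open>z ^ k\<close> in \<open>B(z) ^ r\<close>, where \<open>B(z) = 1 + z * B(z) ^ (m + 1)\<close>.\<close>

fun raney :: "nat \<Rightarrow> nat \<Rightarrow> nat \<Rightarrow> nat" where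
  "raney m 0 r = 1"
| "raney m (Suc k) 0 = 0"
| "raney m (Suc k) (Suc r) = raney m (Suc k) r + raney m k (Suc (r + m))"

lemma raney_zero: "raney m k 0 = of_bool (k = 0)"
  by (cases k) auto

text \<open>This is B^r * B^s = B^(r + s), coefficient by coefficient. The recursion of
  \<open>raney\<close> encodes B^(r + 1) = B^r + z * B^(r + 1 + m): the first summand keeps k and
  lowers r, the second lowers k but raises r, which is why the outer induction on k is over all r
  and s.\<close>

lemma raney_convolution:
  "(\<Sum>j\<le>k. raney m j r * raney m (k - j) s) = raney m k (r + s)"
proof (induction k arbitrary: r s)
  case 0
  show ?case by simp
next
  case (Suc k)
  note IHk = Suc.IH
  show ?case
  proof (induction r)
    case 0
    show ?case by (simp add: raney_zero sum.atMost_Suc_shift)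
  next
    case (Suc r)
    have "(\<Sum>j\<le>Suc k. raney m j (Suc r) * raney m (Suc k - j) s)
        = (\<Sum>j\<le>Suc k. raney m j r * raney m (Suc k - j) s)
          + (\<Sum>j\<le>k. raney m j (Suc (r + m)) * raney m (k - j) s)"
      unfolding sum.atMost_Suc_shift by (simp add: algebra_simps sum.distrib)
    also have "\<dots> = raney m (Suc k) (Suc r + s)"
      unfolding Suc.IH IHk by (simp add: algebra_simps)
    finally show ?case .
  qed
qed

text \<open>Raney's formula, cleared of denominators to stay within the naturals. Absorption
  rewrites both binomials of the recursion as multiples of \<open>Suc n choose Suc k\<close>; their
  coefficients add up to \<open>n * Suc r\<close>, and the positive \<open>n\<close>
  cancels.\<close>

lemma raney_closed_form:
  "(Suc m * k + r) * raney m k r = r * ((Suc m * k + r) choose k)"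
proof (induction m k r rule: raney.induct)
  case (1 m r)
  then show ?case by simp
next
  case (2 m k)
  then show ?case by simp
next
  case (3 m k r)
  define n where "n = Suc m * Suc k + r"
  have IH1: "n * raney m (Suc k) r = r * (n choose Suc k)"
    using 3(1) by (simp add: n_def)
  have n': "Suc m * k + Suc (r + m) = n" by (simp add: n_def)
  have IH2: "n * raney m k (Suc (r + m)) = Suc (r + m) * (n choose k)"
    using 3(2) unfolding n' .
  have a: "Suc k * (Suc n choose Suc k) = Suc n * (n choose k)"
    by (metis Suc_times_binomial_eq mult.commute)
  have b: "(Suc n - Suc k) * (Suc n choose Suc k) = Suc n * (n choose Suc k)"
    by (metis binomial_absorb_comp diff_Suc_1)
  have kn: "k \<le> n" by (simp add: n_def)
  have "n * (Suc n * raney m (Suc k) (Suc r))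
      = Suc n * (r * (n choose Suc k)) + Suc n * (Suc (r + m) * (n choose k))"
    using IH1 IH2 by (simp add: algebra_simps)
  also have "\<dots> = (r * (Suc n - Suc k) + Suc (r + m) * Suc k) * (Suc n choose Suc k)"
    by (simp only: add_mult_distrib mult.assoc a b mult.left_commute[of "Suc n"])
  also have "r * (Suc n - Suc k) + Suc (r + m) * Suc k = n * Suc r"
    using kn by (simp add: n_def algebra_simps)
  finally have "n * (Suc n * raney m (Suc k) (Suc r)) = n * (Suc r * (Suc n choose Suc k))"
    by (simp only: mult.assoc)
  moreover have "n \<noteq> 0" by (simp add: n_def)
  ultimately have "Suc n * raney m (Suc k) (Suc r) = Suc r * (Suc n choose Suc k)"
    by (metis mult_cancel1)
  moreover have "Suc m * Suc k + Suc r = Suc n" by (simp add: n_def)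
  ultimately show ?case by (simp only:)
qed

lemma fuss_catalan_raney: "fuss_catalan m k = real (raney m k 1)"
proof -
  define n where "n = m * k + k"
  have kn: "Suc n - k = m * k + 1" by (simp add: n_def)
  have "Suc n * raney m k 1 = Suc n choose k"
    using raney_closed_form[of m k 1] by (simp add: n_def algebra_simps)
  moreover have "(Suc n - k) * (Suc n choose k) = Suc n * (n choose k)"
    by (metis binomial_absorb_comp diff_Suc_1)
  ultimately have "Suc n * ((m * k + 1) * raney m k 1) = Suc n * (n choose k)"
    unfolding kn by (metis mult.left_commute)
  hence "(m * k + 1) * raney m k 1 = n choose k" by (simp only: mult_cancel1) simp
  hence "real (m * k + 1) * real (raney m k 1) = real (n choose k)"
    by (metis of_nat_mult)
  moreover have "real (m * k + 1) \<noteq> 0" by (simp only: of_nat_eq_0_iff)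
  ultimately show ?thesis
    unfolding fuss_catalan_def n_def by (metis nonzero_mult_div_cancel_left)
qed

text \<open>The stack holds the letters still waiting for a partner. Only its top may be matched,
  which is the noncrossing condition, and only by the opposite letter. Tree walks obey the same
  recursion, with a choice of vertex at every push.\<close>

fun pairings :: "bool list \<Rightarrow> bool list \<Rightarrow> nat" where
  "pairings s [] = of_bool (s = [])"
| "pairings s (a # w) = pairings (a # s) w +
     (case s of [] \<Rightarrow> 0 | b # s' \<Rightarrow> if b = (\<not> a) then pairings s' w else 0)"

lemma pairings_short: "length w < length s \<Longrightarrow> pairings s w = 0"
  by (induction s w rule: pairings.induct) (auto split: list.splits)

text \<open>The word is split at the letter that removes \<open>a\<close> from the stack.\<close>

lemma pairings_append_Cons:
  "pairings (s1 @ a # s) w =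
     (\<Sum>k<length w. of_bool (w ! k = (\<not> a)) * pairings s1 (take k w) * pairings s (drop (Suc k) w))"
proof (induction w arbitrary: s1)
  case Nil
  show ?case by simp
next
  case (Cons b w)
  show ?case
  proof (cases s1)
    case Nil
    show ?thesis using Cons.IH[of "[b]"]
      by (cases a; cases b) (simp_all add: Nil sum.lessThan_Suc_shift del: sum.lessThan_Suc)
  next
    case (Cons c s1')
    show ?thesis using Cons.IH[of "b # s1"] Cons.IH[of s1']
      by (cases "c = (\<not> b)") (simp_all add: Cons sum.lessThan_Suc_shift sum.distrib algebra_simps del: sum.lessThan_Suc)
  qed
qed

section \<open>Letter balance and segments of the periodic block word\<close>

definition word_height :: "bool list \<Rightarrow> int" where
  "word_height w = (\<Sum>a\<leftarrow>w. if a then 1 else -1)"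

text \<open>The total height of stack and remaining word is invariant: a push moves a letter from
  one to the other, and a match deletes two opposite letters.\<close>

lemma pairings_unbalanced: "pairings s w \<noteq> 0 \<Longrightarrow> word_height s + word_height w = 0"
proof (induction s w rule: pairings.induct)
  case (1 s)
  then show ?case by (auto simp: word_height_def)
next
  case (2 s a w)
  then show ?case by (auto simp: word_height_def split: list.splits if_splits)
qed

lemma pairings_map_Not: "pairings (map Not s) (map Not w) = pairings s w"
  by (induction s w rule: pairings.induct) (auto split: list.splits)

text \<open>Words are addressed as segments of one infinite periodic word. Removing the first letter
  and its partner from a segment leaves two segments of the same word, so the recursion stays within
  this family.\<close>

definition block_letter :: "nat \<Rightarrow> nat \<Rightarrow> bool" where
  "block_letter m i \<longleftrightarrow> even (i div m)"

definition block_pairings :: "nat \<Rightarrow> nat \<Rightarrow> nat \<Rightarrow> nat" where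
  "block_pairings m i j = pairings [] (map (block_letter m) [i..<j])"

lemma block_pairings_rec:
  assumes "i < j"
  shows "block_pairings m i j =
    (\<Sum>c\<in>{i<..<j}. of_bool (block_letter m c = (\<not> block_letter m i)) *
        block_pairings m (Suc i) c * block_pairings m (Suc c) j)"
proof -
  have "map (block_letter m) [i..<j] = block_letter m i # map (block_letter m) [Suc i..<j]"
    using assms by (simp add: upt_conv_Cons)
  \<comment> \<open>On an empty stack the first letter can only be pushed, so the count is that for
    the stack consisting of this letter.\<close>
  hence "block_pairings m i j = pairings ([] @ block_letter m i # []) (map (block_letter m) [Suc i..<j])"
    by (simp add: block_pairings_def)
  also have "\<dots> = (\<Sum>k<j - Suc i. of_bool (block_letter m (Suc i + k) = (\<not> block_letter m i)) *
      block_pairings m (Suc i) (Suc i + k) * block_pairings m (Suc (Suc i + k)) j)"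
    unfolding pairings_append_Cons
    by (intro sum.cong) (auto simp: block_pairings_def take_map drop_map take_upt drop_upt)
  also have "\<dots> = (\<Sum>c\<in>{i<..<j}. of_bool (block_letter m c = (\<not> block_letter m i)) *
        block_pairings m (Suc i) c * block_pairings m (Suc c) j)"
    by (rule sum.reindex_bij_witness[of _ "\<lambda>c. c - Suc i" "\<lambda>k. Suc i + k"]) auto
  finally show ?thesis .
qed

lemma block_pairings_self: "block_pairings m i i = 1"
  by (simp add: block_pairings_def)

lemma block_pairings_shift:
  assumes "m > 0"
  shows "block_pairings m (i + m) (j + m) = block_pairings m i j"
proof -
  have "map (block_letter m) [i + m..<j + m] = map Not (map (block_letter m) [i..<j])"
  proof -
    have "block_letter m (i + m) = (\<not> block_letter m i)" for i
      using assms by (simp add: block_letter_def)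
    from this[of "i + k" for k] show ?thesis by (intro nth_equalityI) (simp_all add: ac_simps)
  qed
  thus ?thesis unfolding block_pairings_def by (metis list.map(1) pairings_map_Not)
qed

lemma block_pairings_shift_mult:
  assumes "m > 0"
  shows "block_pairings m (i + n * m) (j + n * m) = block_pairings m i j"
proof (induction n)
  case (Suc n)
  show ?case using block_pairings_shift[OF assms, of "i + n * m" "j + n * m"] Suc
    by (simp add: algebra_simps)
qed simp

text \<open>The sawtooth profile of the word, that is, the partial sums of its letters from position
  0, in closed form.\<close>

definition block_height :: "nat \<Rightarrow> nat \<Rightarrow> int" where
  "block_height m i = (if block_letter m i then int (i mod m) else int m - int (i mod m))"

lemma block_height_Suc:
  assumes "m > 0"
  shows "block_height m (Suc i) = block_height m i + (if block_letter m i then 1 else -1)"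
proof (cases "Suc (i mod m) = m")
  case True
  hence "Suc i div m = Suc (i div m)" "Suc i mod m = 0"
    by (simp_all add: div_Suc mod_Suc)
  thus ?thesis using True by (auto simp: block_height_def block_letter_def)
next
  case False
  hence "Suc i div m = i div m" "Suc i mod m = Suc (i mod m)"
    by (simp_all add: div_Suc mod_Suc)
  thus ?thesis by (auto simp: block_height_def block_letter_def)
qed

lemma word_height_block:
  assumes "m > 0" "i \<le> j"
  shows "word_height (map (block_letter m) [i..<j]) = block_height m j - block_height m i"
  using assms(2)
  by (induction j rule: dec_induct) (auto simp: word_height_def block_height_Suc[OF assms(1)])

lemma block_pairings_unbalanced:
  assumes "m > 0" "i \<le> j" "block_pairings m i j \<noteq> 0"
  shows "block_height m i = block_height m j"
  using pairings_unbalanced[of "[]" "map (block_letter m) [i..<j]"] assms word_height_block[OF assms(1,2)]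
  by (simp add: block_pairings_def word_height_def)

text \<open>The partner of an ascending letter at height \<open>h\<close> must descend from
  \<open>h + 1\<close> to \<open>h\<close>. The sawtooth has exactly one such position per period
  \<open>2 * m\<close>.\<close>

lemma block_partner:
  assumes m: "m > 0" and h: "h < m"
    and c: "\<not> block_letter m c" "block_height m c = int h + 1"
  obtains k where "c = 2 * m - Suc h + k * (2 * m)"
proof -
  obtain k where k: "c div m = Suc (2 * k)"
    using c(1) unfolding block_letter_def by (metis oddE Suc_eq_plus1)
  have "int (c mod m) = int m - int h - 1" using c by (simp add: block_height_def)
  hence "c mod m = m - Suc h" using h by linarith
  hence "c = Suc (2 * k) * m + (m - Suc h)" using div_mult_mod_eq[of c m] k by simp
  hence "c = 2 * m - Suc h + k * (2 * m)" using h by (simp add: algebra_simps)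
  thus ?thesis by (rule that)
qed

lemma block_letter_partner:
  assumes "h < m"
  shows "\<not> block_letter m (2 * m - Suc h + k * (2 * m))"
proof -
  have eq: "2 * m - Suc h + k * (2 * m) = (m - Suc h) + Suc (2 * k) * m"
    using assms by (simp add: algebra_simps)
  have "(2 * m - Suc h + k * (2 * m)) div m = Suc (2 * k)"
    unfolding eq using assms by (subst div_mult_self1) auto
  thus ?thesis by (simp add: block_letter_def)
qed

text \<open>The inner segment has nonzero count only if both its ends have height
  \<open>h + 1\<close>. This leaves one candidate partner per period, and the sum over positions
  becomes a sum over periods.\<close>

lemma block_pairings_up_rec:
  assumes m: "m > 0" and h: "h < m" and d: "0 < d"
  shows "block_pairings m h (h + d) =
    (\<Sum>k | 2 * m - Suc h + k * (2 * m) < h + d.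
        block_pairings m (Suc h) (Suc h + (2 * (m - Suc h) + k * (2 * m)))
        * block_pairings m (2 * m - h + k * (2 * m)) (h + d))"
proof -
  define c where "c k = 2 * m - Suc h + k * (2 * m)" for k
  have inj: "inj c" using m by (auto simp: inj_def c_def)
  have letter_h: "block_letter m h" using h by (simp add: block_letter_def)
  have ht: "block_height m (Suc h) = int h + 1"
    using block_height_Suc[OF m, of h] letter_h h by (simp add: block_height_def)
  have "block_pairings m h (h + d) =
    (\<Sum>x\<in>{h<..<h + d}. of_bool (block_letter m x = (\<not> block_letter m h)) *
        block_pairings m (Suc h) x * block_pairings m (Suc x) (h + d))"
    by (rule block_pairings_rec) (use d in simp)
  also have "\<dots> = (\<Sum>x\<in>c ` {k. c k < h + d}. block_pairings m (Suc h) x * block_pairings m (Suc x) (h + d))"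
  proof (rule sum.mono_neutral_cong_right)
    show "c ` {k. c k < h + d} \<subseteq> {h<..<h + d}" using h by (auto simp: c_def)
    show "\<forall>x\<in>{h<..<h + d} - c ` {k. c k < h + d}.
       of_bool (block_letter m x = (\<not> block_letter m h)) * block_pairings m (Suc h) x * block_pairings m (Suc x) (h + d) = 0"
    proof (intro ballI, rule ccontr)
      fix x assume x: "x \<in> {h<..<h + d} - c ` {k. c k < h + d}"
        and ne: "of_bool (block_letter m x = (\<not> block_letter m h)) * block_pairings m (Suc h) x * block_pairings m (Suc x) (h + d) \<noteq> 0"
      have "\<not> block_letter m x" "block_pairings m (Suc h) x \<noteq> 0"
        using ne letter_h by (auto split: if_splits)
      moreover from this(2) have "block_height m x = int h + 1"
        using block_pairings_unbalanced[OF m, of "Suc h" x] x ht by auto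
      ultimately obtain k where "x = c k" unfolding c_def using block_partner[OF m h] by blast
      thus False using x by auto
    qed
  qed (use block_letter_partner[OF h] letter_h in \<open>auto simp: c_def\<close>)
  also have "\<dots> = (\<Sum>k | c k < h + d. block_pairings m (Suc h) (c k) * block_pairings m (Suc (c k)) (h + d))"
    by (simp add: sum.reindex[OF inj_on_subset[OF inj subset_UNIV]])
  also have "\<dots> = (\<Sum>k | c k < h + d.
        block_pairings m (Suc h) (Suc h + (2 * (m - Suc h) + k * (2 * m)))
        * block_pairings m (2 * m - h + k * (2 * m)) (h + d))"
  proof (intro sum.cong refl)
    fix k
    have "Suc h + (2 * (m - Suc h) + k * (2 * m)) = c k" "2 * m - h + k * (2 * m) = Suc (c k)"
      using h by (auto simp: c_def)
    thus "block_pairings m (Suc h) (c k) * block_pairings m (Suc (c k)) (h + d) =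
        block_pairings m (Suc h) (Suc h + (2 * (m - Suc h) + k * (2 * m)))
        * block_pairings m (2 * m - h + k * (2 * m)) (h + d)" by simp
  qed
  finally show ?thesis by (simp add: c_def)
qed

text \<open>Both segments start and end at height \<open>h\<close> and start in an ascending block; the first ends in an
  ascending block as well, the second in a descending one. The recursion on the first letter links
  the two kinds, because a shift by \<open>m\<close> exchanges the letters and turns height \<open>h\<close> into \<open>m - h\<close>.\<close>

lemma block_pairings_raney:
  assumes m: "m > 0" and h: "h \<le> m"
  shows "block_pairings m h (h + k * (2 * m)) = raney m k 1"
    and "block_pairings m h (h + (2 * (m - h) + k * (2 * m))) = raney m k (Suc (m - h))"
proof -
  have "\<forall>h\<le>m. (\<forall>k. d = k * (2 * m) \<longrightarrow> block_pairings m h (h + d) = raney m k 1) \<and>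
     (\<forall>k. d = 2 * (m - h) + k * (2 * m) \<longrightarrow> block_pairings m h (h + d) = raney m k (Suc (m - h)))" for d
  proof (induction d rule: less_induct)
    case (less d)
    have IH1: "block_pairings m h (h + e) = raney m k 1" if "e < d" "h \<le> m" "e = k * (2 * m)" for e h k
      using less[OF that(1)] that(2,3) by blast
    have IH2: "block_pairings m h (h + e) = raney m k (Suc (m - h))"
      if "e < d" "h \<le> m" "e = 2 * (m - h) + k * (2 * m)" for e h k
      using less[OF that(1)] that(2,3) by blast
    have up: "block_pairings m (Suc h) (Suc h + (2 * (m - Suc h) + j * (2 * m))) = raney m j (m - h)"
      if "h < m" "2 * (m - Suc h) + j * (2 * m) < d" for h j
    proof -
      have "block_pairings m (Suc h) (Suc h + (2 * (m - Suc h) + j * (2 * m))) = raney m j (Suc (m - Suc h))"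
        by (rule IH2) (use that in auto)
      thus ?thesis using that(1) by (simp add: Suc_diff_Suc)
    qed
    have down: "block_pairings m (2 * m - h + j * (2 * m)) (h + d)
      = block_pairings m (m - h) (m - h + e)"
      if "h \<le> m" "h + d = 2 * m - h + j * (2 * m) + e" for h j e
    proof -
      have "2 * m - h + j * (2 * m) = m - h + Suc (2 * j) * m"
        "h + d = m - h + e + Suc (2 * j) * m" using that by (auto simp: algebra_simps)
      thus ?thesis using block_pairings_shift_mult[OF m] by metis
    qed
    have A: "block_pairings m h (h + d) = raney m k 1" if h: "h < m" and d: "d = k * (2 * m)" for h k
    proof (cases k)
      case 0
      thus ?thesis using d by (simp add: block_pairings_self)
    next
      case (Suc k')
      have set: "{j. 2 * m - Suc h + j * (2 * m) < h + d} = {..k'}"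
      proof (intro Set.set_eqI)
        fix j
        show "j \<in> {j. 2 * m - Suc h + j * (2 * m) < h + d} \<longleftrightarrow> j \<in> {..k'}"
        proof (cases "j \<le> k'")
          case True
          have "2 * m - Suc h + j * (2 * m) < h + d"
            unfolding d Suc mult_Suc using mult_le_mono1[OF True, of "2 * m"] h by linarith
          thus ?thesis using True by simp
        next
          case False
          hence "Suc k' \<le> j" by simp
          hence "\<not> 2 * m - Suc h + j * (2 * m) < h + d"
            unfolding d Suc mult_Suc using mult_le_mono1[of "Suc k'" j "2 * m"] h by simp
          thus ?thesis using False by simp
        qed
      qed
      have "block_pairings m h (h + d) = (\<Sum>j\<le>k'.
        block_pairings m (Suc h) (Suc h + (2 * (m - Suc h) + j * (2 * m)))
        * block_pairings m (2 * m - h + j * (2 * m)) (h + d))"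
        using block_pairings_up_rec[OF m h, of d] m unfolding set by (simp add: d Suc)
      also have "\<dots> = (\<Sum>j\<le>k'. raney m j (m - h) * raney m (k' - j) (Suc h))"
      proof (intro sum.cong refl)
        fix j assume "j \<in> {..k'}"
        then obtain i where i: "k' = j + i" by (auto simp: le_iff_add)
        have "block_pairings m (Suc h) (Suc h + (2 * (m - Suc h) + j * (2 * m))) = raney m j (m - h)"
          using h by (intro up) (auto simp: d Suc i algebra_simps)
        moreover have "block_pairings m (2 * m - h + j * (2 * m)) (h + d)
            = block_pairings m (m - h) (m - h + (2 * h + i * (2 * m)))"
          using h by (intro down) (auto simp: d Suc i algebra_simps)
        moreover have "block_pairings m (m - h) (m - h + (2 * h + i * (2 * m))) = raney m i (Suc h)"
        proof -
          have e: "2 * h + i * (2 * m) < d" "2 * h + i * (2 * m) = 2 * (m - (m - h)) + i * (2 * m)"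
            using h by (simp_all add: d Suc i algebra_simps)
          show ?thesis using IH2[OF e(1) diff_le_self e(2)] h by simp
        qed
        ultimately show "block_pairings m (Suc h) (Suc h + (2 * (m - Suc h) + j * (2 * m)))
        * block_pairings m (2 * m - h + j * (2 * m)) (h + d) = raney m j (m - h) * raney m (k' - j) (Suc h)"
          by (simp add: i)
      qed
      \<comment> \<open>The exponents add up to \<open>Suc m\<close>, and by B = 1 + z * B^(m + 1)
        the coefficient of z^k' in B^(m + 1) is that of z^(k' + 1) in B.\<close>
      also have "\<dots> = raney m k 1" unfolding raney_convolution using h by (simp add: Suc)
      finally show ?thesis .
    qed
    \<comment> \<open>Position \<open>m\<close> already opens a descending block, so the recursion
      for \<open>h < m\<close> does not reach it; the shift by \<open>m\<close> reduces it to
      \<open>h = 0\<close>.\<close>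
    have A': "block_pairings m m (m + d) = block_pairings m 0 (0 + d)"
      using block_pairings_shift[OF m, of 0 d] by (simp add: add.commute)
    have AA: "block_pairings m h (h + d) = raney m k 1" if "h \<le> m" "d = k * (2 * m)" for h k
      using A[of h k] A[of 0 k] A' that m by (cases "h = m") auto
    have B: "block_pairings m h (h + d) = raney m k (Suc (m - h))"
      if h: "h \<le> m" and d: "d = 2 * (m - h) + k * (2 * m)" for h k
    proof (cases "h = m")
      case True
      thus ?thesis using AA[of h k] d by simp
    next
      case False
      hence h: "h < m" using h by simp
      have set: "{j. 2 * m - Suc h + j * (2 * m) < h + d} = {..k}"
      proof (intro Set.set_eqI)
        fix j
        show "j \<in> {j. 2 * m - Suc h + j * (2 * m) < h + d} \<longleftrightarrow> j \<in> {..k}"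
        proof (cases "j \<le> k")
          case True
          have "2 * m - Suc h + j * (2 * m) < h + d"
            unfolding d using mult_le_mono1[OF True, of "2 * m"] h by linarith
          thus ?thesis using True by simp
        next
          case False
          hence "Suc k \<le> j" by simp
          hence "\<not> 2 * m - Suc h + j * (2 * m) < h + d"
            unfolding d using mult_le_mono1[of "Suc k" j "2 * m"] h by simp
          thus ?thesis using False by simp
        qed
      qed
      have "block_pairings m h (h + d) = (\<Sum>j\<le>k.
        block_pairings m (Suc h) (Suc h + (2 * (m - Suc h) + j * (2 * m)))
        * block_pairings m (2 * m - h + j * (2 * m)) (h + d))"
        using block_pairings_up_rec[OF m h, of d] h unfolding set by (simp add: d)
      also have "\<dots> = (\<Sum>j\<le>k. raney m j (m - h) * raney m (k - j) 1)"
      proof (intro sum.cong refl)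
        fix j assume "j \<in> {..k}"
        then obtain i where i: "k = j + i" by (auto simp: le_iff_add)
        have "block_pairings m (Suc h) (Suc h + (2 * (m - Suc h) + j * (2 * m))) = raney m j (m - h)"
          using h by (intro up) (auto simp: d i algebra_simps)
        moreover have "block_pairings m (2 * m - h + j * (2 * m)) (h + d)
            = block_pairings m (m - h) (m - h + i * (2 * m))"
          using h by (intro down) (auto simp: d i algebra_simps)
        moreover have "block_pairings m (m - h) (m - h + i * (2 * m)) = raney m i 1"
          using h by (intro IH1) (simp_all add: d i algebra_simps)
        ultimately show "block_pairings m (Suc h) (Suc h + (2 * (m - Suc h) + j * (2 * m)))
        * block_pairings m (2 * m - h + j * (2 * m)) (h + d) = raney m j (m - h) * raney m (k - j) 1"
          by (simp add: i)
      qed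
      also have "\<dots> = raney m k (Suc (m - h))" unfolding raney_convolution by simp
      finally show ?thesis .
    qed
    show ?case using AA B by blast
  qed
  note main = conjunct1[OF this[THEN spec, THEN mp, OF h], THEN spec, THEN mp, OF refl]
    conjunct2[OF this[THEN spec, THEN mp, OF h], THEN spec, THEN mp, OF refl]
  show "block_pairings m h (h + k * (2 * m)) = raney m k 1"
    and "block_pairings m h (h + (2 * (m - h) + k * (2 * m))) = raney m k (Suc (m - h))"
    by (rule main)+
qed

lemma block_word:
  assumes "m > 0"
  shows "map (block_letter m) [0..<k * (2 * m)] = concat (replicate k (replicate m True @ replicate m False))"
proof (induction k)
  case (Suc k)
  have 1: "map (block_letter m) [0..<m] = replicate m True"
    by (intro nth_equalityI) (auto simp: block_letter_def)
  have 2: "map (block_letter m) [m..<2 * m] = replicate m False"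
  proof (intro nth_equalityI)
    fix i assume "i < length (map (block_letter m) [m..<2 * m])"
    hence "(m + i) div m = 1" using assms by simp
    thus "map (block_letter m) [m..<2 * m] ! i = replicate m False ! i"
      using \<open>i < _\<close> by (simp add: block_letter_def)
  qed simp
  have p: "block_letter m (2 * m + i) = block_letter m i" for i
  proof -
    have "(2 * m + i) div m = 2 + i div m" using assms by (simp add: div_mult_self3)
    thus ?thesis by (simp add: block_letter_def)
  qed
  have 3: "map (block_letter m) [2 * m..<2 * m + k * (2 * m)] = map (block_letter m) [0..<k * (2 * m)]"
    by (intro nth_equalityI) (auto simp: p)
  have "[0..<Suc k * (2 * m)] = [0..<m] @ [m..<2 * m] @ [2 * m..<2 * m + k * (2 * m)]"
    by (metis add_0 append_assoc le_add1 mult_2 mult_Suc upt_add_eq_append zero_le)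
  thus ?case using 1 2 3 Suc by simp
qed simp

lemma pairings_block_word:
  assumes "m > 0"
  shows "real (pairings [] (concat (replicate k (replicate m True @ replicate m False)))) = fuss_catalan m k"
  using block_pairings_raney(1)[OF assms le0, of k]
  unfolding block_pairings_def block_word[OF assms, symmetric] fuss_catalan_raney add_0 by (simp only:)

section \<open>Tree walks\<close>

text \<open>An edge is the matrix position read by a step, not the step itself. Equal pairs mean the
  same random variable, and (i, k) and (k, i) count as different edges, since these entries are
  independent.\<close>

fun walk_edges :: "'v \<Rightarrow> bool list \<Rightarrow> 'v list \<Rightarrow> ('v \<times> 'v) list" where
  "walk_edges i (a # w) (k # ks) = (if a then (i, k) else (k, i)) # walk_edges k w ks"
| "walk_edges i _ _ = []"

text \<open>The automaton of \<open>pairings\<close> with vertices added: a stack item records the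
  letter that opened an edge and the vertex left behind. A visited vertex may be entered only by
  undoing the top item, and the opposite letter is what reads the same matrix position
  backwards.\<close>

fun tree_walk :: "(bool \<times> 'v) list \<Rightarrow> 'v set \<Rightarrow> 'v \<Rightarrow> bool list \<Rightarrow> 'v list \<Rightarrow> bool" where
  "tree_walk P V i [] ks \<longleftrightarrow> P = [] \<and> ks = []"
| "tree_walk P V i (a # w) [] \<longleftrightarrow> False"
| "tree_walk P V i (a # w) (k # ks) \<longleftrightarrow>
     (if k \<in> V then (\<exists>P'. P = (\<not> a, k) # P' \<and> tree_walk P' V k w ks)
      else tree_walk ((a, i) # P) (insert k V) k w ks)"

text \<open>Started with an empty stack, a tree walk is therefore closed, so closedness need not be
  imposed when such walks are counted.\<close>

lemma tree_walk_last:
  "tree_walk P V i w ks \<Longrightarrow> last (i # ks) = (if P = [] then i else snd (last P))"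
proof (induction P V i w ks rule: tree_walk.induct)
  case (3 P V i a w k ks)
  show ?case
  proof (cases "k \<in> V")
    case True
    then obtain P' where P': "P = (\<not> a, k) # P'" "tree_walk P' V k w ks"
      using 3(3) by auto
    show ?thesis using 3(1)[OF True P'(2)] P'(1) by auto
  next
    case False
    thus ?thesis using 3(2,3) by auto
  qed
qed auto

text \<open>Every step to a new vertex uses a new edge, so the number of edges minus the number of
  vertices never decreases along a walk.\<close>

lemma card_walk_vertices:
  assumes "finite V" "i \<in> V" "E \<subseteq> V \<times> V" "length ks = length w"
  shows "card (V \<union> set ks) + card E \<le> card V + card (E \<union> set (walk_edges i w ks))"
  using assms
proof (induction i w ks arbitrary: V E rule: walk_edges.induct)
  case (1 i a w k ks)
  define e where "e = (if a then (i, k) else (k, i))"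
  have fE: "finite E" using 1(2,4) finite_subset by blast
  have "card (insert k V \<union> set ks) + card (insert e E)
      \<le> card (insert k V) + card (insert e E \<union> set (walk_edges k w ks))"
    using 1(2-5) by (intro 1(1)) (auto simp: e_def)
  moreover have "card (insert k V) + card E \<le> card V + card (insert e E)"
  proof (cases "k \<in> V")
    case True
    thus ?thesis using fE by (simp add: insert_absorb card_insert_le)
  next
    case False
    hence "e \<notin> E" using 1(4) by (auto simp: e_def)
    thus ?thesis using False fE 1(2) by simp
  qed
  ultimately show ?case by (simp add: e_def[symmetric])
qed auto

text \<open>The orientation is that of the opening step, which led from \<open>u\<close> to
  \<open>i\<close>; hence the swap in comparison with \<open>walk_edges\<close>.\<close>

fun path_edges :: "'v \<Rightarrow> (bool \<times> 'v) list \<Rightarrow> ('v \<times> 'v) list" where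
  "path_edges i [] = []"
| "path_edges i ((a, u) # P) = (if a then (u, i) else (i, u)) # path_edges u P"

lemma path_edges_vertices: "e \<in> set (path_edges i P) \<Longrightarrow> fst e \<in> insert i (snd ` set P) \<and> snd e \<in> insert i (snd ` set P)"
  by (induction i P rule: path_edges.induct) (auto split: if_splits)

lemma path_edges_tail:
  "e \<in> set (path_edges u P) \<Longrightarrow> i \<noteq> u \<Longrightarrow> i \<notin> snd ` set P \<Longrightarrow> fst e \<noteq> i \<and> snd e \<noteq> i"
  using path_edges_vertices[of e u P] by auto

text \<open>The stack \<open>P\<close> is the path from the current vertex to the root of the tree explored so far.
  Its edges have been traversed once, all other edges twice. Since no cycle may be closed, the
  only edge at the current vertex that can be traversed again is the top of the stack.\<close>

lemma tree_walkI_aux: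
  assumes "finite V" "i \<in> V" "set E \<subseteq> V \<times> V" "card V = Suc (card (set E))"
    and "distinct (i # map snd P)" "snd ` set P \<subseteq> V"
    and "\<And>e. e \<in> set E \<Longrightarrow> count_list E e = (if e \<in> set (path_edges i P) then 1 else 2)"
    and "set (path_edges i P) \<subseteq> set E"
    and "length ks = length w"
    and "\<And>e. e \<in> set (E @ walk_edges i w ks) \<Longrightarrow> count_list (E @ walk_edges i w ks) e = 2"
    and "card (V \<union> set ks) > card (set (E @ walk_edges i w ks))"
  shows "tree_walk P V i w ks"
  using assms
proof (induction P V i w ks arbitrary: E rule: tree_walk.induct)
  case (1 P V i ks)
  \<comment> \<open>An edge left on the stack at the end would have total count 1 instead of
    2.\<close>
  have "path_edges i P = []"
  proof (rule ccontr)
    assume "path_edges i P \<noteq> []"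
    then obtain e where e: "e \<in> set (path_edges i P)" by (meson hd_in_set)
    hence "e \<in> set E" using 1(8) by auto
    hence "count_list E e = 1" "count_list E e = 2" using 1(7)[of e] 1(10)[of e] e 1(9) by auto
    thus False by simp
  qed
  hence "P = []" by (cases "(i, P)" rule: path_edges.cases) auto
  thus ?case using 1(9) by simp
next
  case (2 P V i a w)
  thus ?case by simp
next
  case (3 P V i a w k ks)
  note prems = 3(3-)
  define e where "e = (if a then (i, k) else (k, i))"
  define E' where "E' = E @ [e]"
  have EE': "E @ walk_edges i (a # w) (k # ks) = E' @ walk_edges k w ks"
    by (simp add: E'_def e_def)
  have fin: "finite V" using prems(1) .
  show ?case
  proof (cases "k \<in> V")
    case False
    hence eE: "e \<notin> set E" using prems(3) by (auto simp: e_def)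
    have ep: "e \<notin> set (path_edges i P)" using eE prems(8) by auto
    have "tree_walk ((a, i) # P) (insert k V) k w ks"
    proof (rule 3(2)[OF False, where E = E'])
      show "finite (insert k V)" "k \<in> insert k V" using fin by auto
      show "set E' \<subseteq> insert k V \<times> insert k V" using prems(2,3) by (auto simp: E'_def e_def)
      show "card (insert k V) = Suc (card (set E'))" using False eE fin prems(4) by (simp add: E'_def)
      show "distinct (k # map snd ((a, i) # P))" using prems(2,5,6) False by auto
      show "snd ` set ((a, i) # P) \<subseteq> insert k V" using prems(2,6) by auto
      show "count_list E' e' = (if e' \<in> set (path_edges k ((a, i) # P)) then 1 else 2)"
        if "e' \<in> set E'" for e'
      proof (cases "e' = e")
        case True
        hence "count_list E' e' = 1" using eE by (simp add: E'_def count_list_0_iff)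
        moreover have "e \<in> set (path_edges k ((a, i) # P))" by (simp add: e_def)
        ultimately show ?thesis using True by simp
      next
        case F: False
        hence "e' \<in> set E" using that by (simp add: E'_def)
        moreover have "e' \<in> set (path_edges k ((a, i) # P)) \<longleftrightarrow> e' \<in> set (path_edges i P)"
          using F by (simp add: e_def)
        ultimately show ?thesis using prems(7)[of e'] F by (simp add: E'_def)
      qed
      show "set (path_edges k ((a, i) # P)) \<subseteq> set E'" using prems(8) by (auto simp: E'_def e_def)
      show "length ks = length w" using prems(9) by simp
      show "count_list (E' @ walk_edges k w ks) e' = 2" if "e' \<in> set (E' @ walk_edges k w ks)" for e'
        using prems(10)[of e'] that unfolding EE' .
      show "card (insert k V \<union> set ks) > card (set (E' @ walk_edges k w ks))"
        using prems(11) unfolding EE' by simp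
    qed
    thus ?thesis using False by simp
  next
    case True
    \<comment> \<open>A new edge between visited vertices would make the number of edges reach that
      of vertices. By \<open>card_walk_vertices\<close> this could not be reversed later, against
      the final surplus of vertices.\<close>
    have eE: "e \<in> set E"
    proof (rule ccontr)
      assume "e \<notin> set E"
      hence c: "card (set E') = Suc (card (set E))" by (simp add: E'_def)
      have "card (V \<union> set ks) + card (set E') \<le> card V + card (set E' \<union> set (walk_edges k w ks))"
        using prems(1-3,9) True by (intro card_walk_vertices) (auto simp: E'_def e_def)
      moreover have "card (V \<union> set ks) > card (set E' \<union> set (walk_edges k w ks))"
        using prems(11) True unfolding EE' by (simp add: insert_absorb)
      ultimately show False using c prems(4) by linarith
    qed
    have "count_list E e < 2"
      using prems(10)[of e] unfolding EE' by (simp add: E'_def)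
    hence ep: "e \<in> set (path_edges i P)" using prems(7)[OF eE] by (auto split: if_splits)
    then obtain b u P' where P: "P = (b, u) # P'"
      by (cases "(i, P)" rule: path_edges.cases) auto
    have iP': "i \<noteq> u" "i \<notin> snd ` set P'" using prems(5) P by auto
    define e0 where "e0 = (if b then (u, i) else (i, u))"
    have pe: "path_edges i P = e0 # path_edges u P'" by (simp add: P e0_def)
    have tail: "e \<notin> set (path_edges u P')"
      using path_edges_tail[OF _ iP', of e] by (auto simp: e_def)
    hence "e = e0" using ep pe by simp
    hence bu: "b = (\<not> a)" "u = k" using iP' by (auto simp: e_def e0_def split: if_splits)
    have "tree_walk P' V k w ks"
    proof (rule 3(1)[OF True, where E = E'])
      show "finite V" "k \<in> V" by fact+
      show "set E' \<subseteq> V \<times> V" using prems(3) eE by (auto simp: E'_def)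
      have sE': "set E' = set E" using eE by (auto simp: E'_def)
      show "card V = Suc (card (set E'))" using prems(4) sE' by simp
      show "distinct (k # map snd P')" "snd ` set P' \<subseteq> V" using prems(5,6) P bu by auto
      show "count_list E' e' = (if e' \<in> set (path_edges k P') then 1 else 2)"
        if "e' \<in> set E'" for e'
        using prems(7)[of e'] that tail ep \<open>e = e0\<close> unfolding pe bu sE' by (auto simp: E'_def)
      show "set (path_edges k P') \<subseteq> set E'" using prems(8) unfolding pe bu sE' by auto
      show "length ks = length w" using prems(9) by simp
      show "count_list (E' @ walk_edges k w ks) e' = 2" if "e' \<in> set (E' @ walk_edges k w ks)" for e'
        using prems(10)[of e'] that unfolding EE' .
      show "card (V \<union> set ks) > card (set (E' @ walk_edges k w ks))"
        using prems(11) True unfolding EE' by (simp add: insert_absorb)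
    qed
    thus ?thesis using True P bu by auto
  qed
qed

text \<open>The surplus of vertices over matrix positions excludes cycles, including loops and pairs
  of opposite entries. The letters are not mentioned in the hypotheses: that the two uses of an edge
  carry opposite letters is a consequence, and it is what keeps \<open>E x^2\<close> out of the
  limit.\<close>

lemma tree_walkI:
  assumes "length ks = length w"
    and "\<And>e. e \<in> set (walk_edges i w ks) \<Longrightarrow> count_list (walk_edges i w ks) e = 2"
    and "card (insert i (set ks)) > card (set (walk_edges i w ks))"
  shows "tree_walk [] {i} i w ks"
  by (rule tree_walkI_aux[where E = "[]"]) (use assms in auto)

lemma card_vertices_le_Suc_edges:
  assumes "length ks = length w"
  shows "card (insert i (set ks)) \<le> Suc (card (set (walk_edges i w ks)))"
  using card_walk_vertices[of "{i}" i "{}" ks w] assms by simp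

section \<open>Letters along the edges of a tree walk\<close>

lemma count_list_zip_bool:
  "length w = length es \<Longrightarrow>
     count_list (zip w es) (True, e) + count_list (zip w es) (False, e) = count_list es e"
  by (induction w es rule: list_induct2) auto

lemma length_walk_edges: "length ks = length w \<Longrightarrow> length (walk_edges i w ks) = length w"
  by (induction i w ks rule: walk_edges.induct) auto

lemma tree_walk_letter_counts_aux:
  assumes "tree_walk P V i w ks" "i \<in> V" "distinct (i # map snd P)" "snd ` set P \<subseteq> V"
  defines "c \<equiv> \<lambda>b e. count_list (zip (map fst P) (path_edges i P)) (b, e)
                    + count_list (zip w (walk_edges i w ks)) (b, e)"
  shows "c True e = c False e \<and> c True e \<le> 1 \<and>
    (e \<in> V \<times> V \<longrightarrow> e \<notin> set (path_edges i P) \<longrightarrow> c True e = 0)"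
  using assms unfolding c_def
proof (induction P V i w ks rule: tree_walk.induct)
  case (3 P V i a w k ks)
  define e0 where "e0 = (if a then (i, k) else (k, i))"
  have we: "walk_edges i (a # w) (k # ks) = e0 # walk_edges k w ks" by (simp add: e0_def)
  show ?case
  proof (cases "k \<in> V")
    case True
    then obtain P' where P: "P = (\<not> a, k) # P'" and walk: "tree_walk P' V k w ks"
      using 3(3) by auto
    have pe: "path_edges i ((\<not> a, k) # P') = e0 # path_edges k P'" by (simp add: e0_def)
    have "i \<noteq> k" "i \<notin> snd ` set P'" using 3(5) P by auto
    hence tail: "e0 \<notin> set (path_edges k P')"
      using path_edges_tail[of e0 k P' i] by (auto simp: e0_def)
    have e0: "e0 \<in> V \<times> V" using True 3(4) by (simp add: e0_def)
    have "distinct (k # map snd P')" "snd ` set P' \<subseteq> V" using 3(5,6) P by auto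
    note IH = 3(1)[OF True walk True this]
    show ?thesis
    proof (cases "e = e0")
      case True
      thus ?thesis using IH tail e0 unfolding P pe we by (cases a) simp_all
    next
      case False
      thus ?thesis using IH unfolding P pe we by simp
    qed
  next
    case False
    have pe: "path_edges k ((a, i) # P) = e0 # path_edges i P" by (simp add: e0_def)
    have "tree_walk ((a, i) # P) (insert k V) k w ks" "distinct (k # map snd ((a, i) # P))" "snd ` set ((a, i) # P) \<subseteq> insert k V"
      using 3(3-6) False by auto
    note IH = 3(2)[OF False this(1) insertI1 this(2,3)]
    have "e0 \<notin> V \<times> V" using False by (simp add: e0_def)
    have eq: "count_list (zip (map fst ((a, i) # P)) (path_edges k ((a, i) # P))) (b, e)
        + count_list (zip w (walk_edges k w ks)) (b, e)
      = count_list (zip (map fst P) (path_edges i P)) (b, e)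
        + count_list (zip (a # w) (walk_edges i (a # w) (k # ks))) (b, e)" for b
      unfolding pe we by simp
    have "e \<in> set (path_edges k ((a, i) # P)) \<longleftrightarrow> e = e0 \<or> e \<in> set (path_edges i P)"
      unfolding pe by simp
    moreover have "e \<in> insert k V \<times> insert k V" if "e \<in> V \<times> V" using that by auto
    ultimately show ?thesis using IH \<open>e0 \<notin> V \<times> V\<close> unfolding eq by metis
  qed
qed auto

lemma tree_walk_letter_counts:
  assumes "tree_walk [] {i} i w ks" "length ks = length w" "e \<in> set (walk_edges i w ks)"
  shows "count_list (zip w (walk_edges i w ks)) (b, e) = 1"
proof -
  have "count_list (walk_edges i w ks) e \<noteq> 0" using assms(3) by (simp add: count_list_0_iff)
  thus ?thesis
    using tree_walk_letter_counts_aux[OF assms(1), of e]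
      count_list_zip_bool[of w "walk_edges i w ks" e] length_walk_edges[OF assms(2), of i]
    by (cases b) auto
qed

lemma tree_walk_card_edges:
  assumes "tree_walk [] {i} i w ks" "length ks = length w"
  shows "2 * card (set (walk_edges i w ks)) = length w"
proof -
  let ?es = "walk_edges i w ks"
  have len: "length ?es = length w" by (rule length_walk_edges[OF assms(2)])
  have "length w = (\<Sum>e\<in>set ?es. count_list ?es e)"
    using sum_count_set[of ?es "set ?es"] len by simp
  also have "\<dots> = (\<Sum>e\<in>set ?es. 2)"
  proof (rule sum.cong)
    fix e assume "e \<in> set ?es"
    thus "count_list ?es e = 2"
      using count_list_zip_bool[of w ?es e] len tree_walk_letter_counts[OF assms] by simp
  qed simp
  finally show ?thesis by simp
qed

lemma tree_walk_length: "tree_walk P V i w ks \<Longrightarrow> length P \<le> length w"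
proof (induction P V i w ks rule: tree_walk.induct)
  case (3 P V i a w k ks)
  thus ?case by (fastforce split: if_splits)
qed auto

section \<open>Counting tree walks and weighting lists by their number of vertices\<close>

lemma Collect_Cons_lists:
  "{ks. length ks = Suc n \<and> set ks \<subseteq> A \<and> Q ks} =
     (\<Union>k\<in>A. (#) k ` {ks. length ks = n \<and> set ks \<subseteq> A \<and> Q (k # ks)})"
  by (auto simp: length_Suc_conv image_iff)

lemma sum_Cons_lists:
  assumes "finite A"
  shows "(\<Sum>ks | length ks = Suc n \<and> set ks \<subseteq> A \<and> Q ks. f ks) =
     (\<Sum>k\<in>A. \<Sum>ks | length ks = n \<and> set ks \<subseteq> A \<and> Q (k # ks). f (k # ks))"
proof -
  have fin: "finite {ks. length ks = n \<and> set ks \<subseteq> A \<and> R ks}" for R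
    by (rule finite_subset[OF _ finite_lists_length_eq[OF assms, of n]]) auto
  show ?thesis unfolding Collect_Cons_lists
    by (subst sum.UNION_disjoint) (auto simp: assms fin sum.reindex)
qed

lemma card_Cons_lists:
  assumes "finite A"
  shows "card {ks. length ks = Suc n \<and> set ks \<subseteq> A \<and> Q ks} =
     (\<Sum>k\<in>A. card {ks. length ks = n \<and> set ks \<subseteq> A \<and> Q (k # ks)})"
  unfolding card_eq_sum by (rule sum_Cons_lists[OF assms])

text \<open>A pop has a forced target and a push may go to any unvisited vertex. The length
  condition says that exactly \<open>q\<close> pushes remain, which gives a falling factorial with
  \<open>q\<close> factors. Subtraction is truncated: if the vertices run out, a factor is 0, as it
  should be.\<close>

lemma card_tree_walks:
  assumes "finite A" "V \<subseteq> A" "i \<in> V" "snd ` set P \<subseteq> V" "length w = length P + 2 * q"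
  shows "card {ks. length ks = length w \<and> set ks \<subseteq> A \<and> tree_walk P V i w ks} =
    pairings (map fst P) w * (\<Prod>j<q. card A - card V - j)"
  using assms
proof (induction w arbitrary: P V i q)
  case Nil
  have "{ks. ks = [] \<and> set ks \<subseteq> A \<and> tree_walk P V i [] ks} = (if P = [] then {[]} else {})"
    by auto
  thus ?case using Nil(5) by auto
next
  case (Cons a w)
  let ?S = "\<lambda>P V i w. {ks. length ks = length w \<and> set ks \<subseteq> A \<and> tree_walk P V i w ks}"
  let ?F = "\<lambda>q V. \<Prod>j<q. card A - card V - j"
  have finV: "finite V" using Cons(2,3) finite_subset by blast
  have new: "(\<Sum>k\<in>A - V. card {ks. length ks = length w \<and> set ks \<subseteq> A \<and> tree_walk P V i (a # w) (k # ks)})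
      = pairings (a # map fst P) w * ?F q V"
  \<comment> \<open>With \<open>q = 0\<close> every remaining letter must pop, so that a push leaves
    too few letters to empty the stack.\<close>
  proof (cases q)
    case 0
    hence l: "length w < length ((a, i) # P)" using Cons(6) by simp
    hence "\<not> tree_walk ((a, i) # P) (insert k V) k w ks" for k ks
      using tree_walk_length by (metis not_less)
    moreover have "pairings (a # map fst P) w = 0" using l by (intro pairings_short) simp
    ultimately show ?thesis by simp
  next
    case (Suc q')
    have "(\<Sum>k\<in>A - V. card {ks. length ks = length w \<and> set ks \<subseteq> A \<and> tree_walk P V i (a # w) (k # ks)})
      = (\<Sum>k\<in>A - V. pairings (a # map fst P) w * (\<Prod>j<q'. card A - Suc (card V) - j))"
    proof (rule sum.cong[OF refl])
      fix k assume k: "k \<in> A - V"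
      have "card (?S ((a, i) # P) (insert k V) k w) =
        pairings (map fst ((a, i) # P)) w * ?F q' (insert k V)"
        using Cons(2-6) k Suc by (intro Cons.IH) auto
      thus "card {ks. length ks = length w \<and> set ks \<subseteq> A \<and> tree_walk P V i (a # w) (k # ks)} =
        pairings (a # map fst P) w * (\<Prod>j<q'. card A - Suc (card V) - j)"
        using k finV by simp
    qed
    also have "\<dots> = pairings (a # map fst P) w * ?F q V"
      using finV Cons(3) by (simp add: Suc prod.lessThan_Suc_shift card_Diff_subset del: prod.lessThan_Suc)
    finally show ?thesis .
  qed
  have old: "(\<Sum>k\<in>V. card {ks. length ks = length w \<and> set ks \<subseteq> A \<and> tree_walk P V i (a # w) (k # ks)})
      = (case map fst P of [] \<Rightarrow> 0 | b # s' \<Rightarrow> if b = (\<not> a) then pairings s' w else 0) * ?F q V"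
  proof (cases "\<exists>k P'. P = (\<not> a, k) # P'")
    case False
    hence "card {ks. length ks = length w \<and> set ks \<subseteq> A \<and> tree_walk P V i (a # w) (k # ks)} = 0"
      if "k \<in> V" for k using that by auto
    thus ?thesis using False by (cases P) auto
  next
    case True
    then obtain k P' where P: "P = (\<not> a, k) # P'" by blast
    have kV: "k \<in> V" using Cons(5) P by auto
    have "(\<Sum>k\<in>V. card {ks. length ks = length w \<and> set ks \<subseteq> A \<and> tree_walk P V i (a # w) (k # ks)})
      = (\<Sum>k\<in>{k}. card (?S P' V k w))"
    proof (rule sum.mono_neutral_cong_right)
      have "k' = k" if "tree_walk P V i (a # w) (k' # ks)" "k' \<in> V" for k' ks
        using that P by auto
      thus "\<forall>k'\<in>V - {k}. card {ks. length ks = length w \<and> set ks \<subseteq> A \<and> tree_walk P V i (a # w) (k' # ks)} = 0"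
        by (auto simp del: tree_walk.simps simp: card_eq_0_iff)
    qed (use kV finV P in auto)
    also have "\<dots> = card (?S P' V k w)" by simp
    also have "\<dots> = pairings (map fst P') w * ?F q V"
      using Cons(2-6) kV P by (intro Cons.IH) auto
    finally show ?thesis by (simp add: P)
  qed
  have "card (?S P V i (a # w)) =
      (\<Sum>k\<in>A. card {ks. length ks = length w \<and> set ks \<subseteq> A \<and> tree_walk P V i (a # w) (k # ks)})"
    unfolding list.size by (simp add: card_Cons_lists[OF Cons(2)] del: tree_walk.simps)
  also have "\<dots> = pairings (map fst P) (a # w) * ?F q V"
    unfolding sum.subset_diff[OF Cons(3,2)] new old by (simp add: algebra_simps)
  finally show ?case .
qed

text \<open>Appending an element multiplies the sum by at most \<open>n + 1\<close>: a fresh element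
  has at most |A| choices, each of weight 1/|A|, and a repeated one has at most \<open>n\<close>
  choices at no cost. The bound is independent of |A|, so walks need not be sorted by shape.\<close>

lemma sum_lists_card_set_le:
  assumes "finite A" "A \<noteq> {}"
  shows "(\<Sum>xs | set xs \<subseteq> A \<and> length xs = n. (1 / real (card A)) ^ card (set xs)) \<le> fact n"
proof (induction n)
  case 0
  have "{xs. set xs \<subseteq> A \<and> length xs = 0} = {[]}" by auto
  thus ?case by simp
next
  case (Suc n)
  define N where "N = real (card A)"
  have N: "N > 0" using assms by (simp add: N_def card_gt_0_iff)
  let ?L = "\<lambda>n. {xs. set xs \<subseteq> A \<and> length xs = n}"
  have "(\<Sum>xs\<in>?L (Suc n). (1 / N) ^ card (set xs)) =
      (\<Sum>(xs, x)\<in>?L n \<times> A. (1 / N) ^ card (set (x # xs)))"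
    unfolding lists_length_Suc_eq
    by (subst sum.reindex[OF inj_split_Cons]) (simp only: case_prod_unfold comp_def)
  also have "\<dots> = (\<Sum>xs\<in>?L n. \<Sum>x\<in>A. (1 / N) ^ card (insert x (set xs)))"
    by (simp add: sum.cartesian_product)
  also have "\<dots> \<le> (\<Sum>xs\<in>?L n. real (Suc n) * (1 / N) ^ card (set xs))"
  proof (rule sum_mono)
    fix xs assume xs: "xs \<in> ?L n"
    have "(\<Sum>x\<in>A. (1 / N) ^ card (insert x (set xs)))
       \<le> (\<Sum>x\<in>A. (1 / N) ^ Suc (card (set xs)) + of_bool (x \<in> set xs) * (1 / N) ^ card (set xs))"
      using N by (intro sum_mono) (simp add: insert_absorb)
    also have "\<dots> = (1 / N) ^ card (set xs) + real (card (A \<inter> set xs)) * (1 / N) ^ card (set xs)"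
      using N assms by (simp add: sum.distrib N_def sum_distrib_right[symmetric] Int_def)
    also have "\<dots> \<le> real (Suc n) * (1 / N) ^ card (set xs)"
    proof -
      have "card (A \<inter> set xs) \<le> n" using xs card_length[of xs] by (simp add: inf.absorb2)
      hence "real (card (A \<inter> set xs)) * (1 / N) ^ card (set xs) \<le> real n * (1 / N) ^ card (set xs)"
        using N by (intro mult_right_mono) auto
      thus ?thesis by (simp add: algebra_simps)
    qed
    finally show "(\<Sum>x\<in>A. (1 / N) ^ card (insert x (set xs))) \<le> real (Suc n) * (1 / N) ^ card (set xs)" .
  qed
  also have "\<dots> \<le> real (Suc n) * fact n"
    using Suc unfolding sum_distrib_left[symmetric] N_def by (intro mult_left_mono) auto
  finally show ?case by (simp add: N_def)
qed

section \<open>Spectral means and traces of words\<close>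

definition mat_trace :: "'a::comm_monoid_add mat \<Rightarrow> 'a" where
  "mat_trace A = (\<Sum>i<dim_row A. A $$ (i, i))"

lemma index_mult_mat_sum:
  assumes "A \<in> carrier_mat n n" "B \<in> carrier_mat n n" "i < n" "j < n"
  shows "(A * B) $$ (i, j) = (\<Sum>k<n. A $$ (i, k) * B $$ (k, j))"
  using assms by (simp add: scalar_prod_def atLeast0LessThan)

lemma mat_trace_mult_commute:
  fixes A B :: "'a::comm_semiring_0 mat"
  assumes "A \<in> carrier_mat n n" "B \<in> carrier_mat n n"
  shows "mat_trace (A * B) = mat_trace (B * A)"
proof -
  have "mat_trace (A * B) = (\<Sum>i<n. \<Sum>k<n. A $$ (i, k) * B $$ (k, i))"
    using assms by (simp add: mat_trace_def index_mult_mat_sum[where n = n] del: index_mult_mat(1))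
  also have "\<dots> = (\<Sum>k<n. \<Sum>i<n. B $$ (k, i) * A $$ (i, k))"
    by (subst sum.swap) (simp add: mult.commute)
  also have "\<dots> = mat_trace (B * A)"
    using assms by (simp add: mat_trace_def index_mult_mat_sum[where n = n] del: index_mult_mat(1))
  finally show ?thesis .
qed

lemma upper_triangular_mult:
  fixes A B :: "'a::semiring_0 mat"
  assumes "A \<in> carrier_mat n n" "B \<in> carrier_mat n n" "upper_triangular A" "upper_triangular B"
  shows "upper_triangular (A * B)"
    and "\<And>i. i < n \<Longrightarrow> (A * B) $$ (i, i) = A $$ (i, i) * B $$ (i, i)"
proof -
  have z: "A $$ (i, k) * B $$ (k, j) = 0" if "i < n" "k < n" "j \<le> i" "k \<noteq> i \<or> j < i" for i j k
  proof (cases "k < i")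
    case True
    thus ?thesis using assms that by (auto dest: upper_triangularD)
  next
    case False
    hence "j < k" using that by auto
    thus ?thesis using assms that by (auto dest: upper_triangularD)
  qed
  show "upper_triangular (A * B)"
  proof (rule upper_triangularI)
    fix i j assume ij: "j < i" "i < dim_row (A * B)"
    thus "(A * B) $$ (i, j) = 0"
      using assms z by (simp add: index_mult_mat_sum[where n = n] del: index_mult_mat(1))
  qed
  fix i assume i: "i < n"
  have "(A * B) $$ (i, i) = (\<Sum>k<n. A $$ (i, k) * B $$ (k, i))"
    by (rule index_mult_mat_sum[OF assms(1,2) i i])
  also have "\<dots> = (\<Sum>k\<in>{i}. A $$ (i, k) * B $$ (k, i))"
    using i z by (intro sum.mono_neutral_right) auto
  finally show "(A * B) $$ (i, i) = A $$ (i, i) * B $$ (i, i)" by simp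
qed

lemma upper_triangular_pow:
  fixes A :: "'a::semiring_1 mat"
  assumes "A \<in> carrier_mat n n" "upper_triangular A"
  shows "upper_triangular (A ^\<^sub>m p) \<and> (\<forall>i<n. (A ^\<^sub>m p) $$ (i, i) = A $$ (i, i) ^ p)"
proof (induction p)
  case (Suc p)
  have "A ^\<^sub>m p \<in> carrier_mat n n" using assms(1) by simp
  thus ?case using upper_triangular_mult[OF _ assms(1) _ assms(2), of "A ^\<^sub>m p"] Suc
    by (simp add: power_commutes)
qed (use assms in auto)

text \<open>Schur triangularisation: the diagonal of the triangular form lists the roots with
  multiplicity, its powers are taken entrywise, and the change of basis disappears under the
  trace.\<close>

lemma mat_trace_pow_proots:
  fixes A :: "complex mat"
  assumes A: "A \<in> carrier_mat n n"
  shows "mat_trace (A ^\<^sub>m p) = (\<Sum>z\<in>#proots (char_poly A). z ^ p)"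
    and "size (proots (char_poly A)) = n"
proof -
  obtain es where "char_poly A = (\<Prod>a\<leftarrow>es. [:- a, 1:])"
    using char_poly_factorized[OF A] by blast
  then obtain B where B: "B \<in> carrier_mat n n" "upper_triangular B" "similar_mat A B"
    using schur_decomposition_exists[OF A] by blast
  have "char_poly A = (\<Prod>a\<leftarrow>diag_mat B. [:- a, 1:])"
    using char_poly_similar[OF B(3)] char_poly_upper_triangular[OF B(1,2)] by simp
  moreover have "proots (\<Prod>a\<leftarrow>as. [:- a, 1:]) = mset as" for as :: "complex list"
  proof (induction as)
    case (Cons a as)
    have "(\<Prod>a\<leftarrow>as. [:- a, 1:]) \<noteq> 0" by (auto simp: prod_list_zero_iff)
    thus ?case using Cons by (simp add: proots_mult del: mult_pCons_left)
  qed simp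
  ultimately have roots: "proots (char_poly A) = mset (diag_mat B)" by simp
  thus "size (proots (char_poly A)) = n" using B(1) by (simp add: diag_mat_def)
  obtain P Q where PQ: "similar_mat_wit A B P Q" using B(3) by (auto simp: similar_mat_def)
  note w = similar_mat_witD2[OF A PQ]
  have Bp: "B ^\<^sub>m p \<in> carrier_mat n n" using B(1) by simp
  have "mat_trace (A ^\<^sub>m p) = mat_trace (P * (B ^\<^sub>m p * Q))"
    using similar_mat_wit_pow_id[OF PQ, of p] assoc_mult_mat[OF w(6) Bp w(7)] by simp
  also have "\<dots> = mat_trace (B ^\<^sub>m p * Q * P)"
    by (rule mat_trace_mult_commute) (use w Bp in auto)
  also have "B ^\<^sub>m p * Q * P = B ^\<^sub>m p"
    using w Bp by (simp add: assoc_mult_mat[OF Bp w(7,6)])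
  also have "mat_trace (B ^\<^sub>m p) = (\<Sum>z\<leftarrow>diag_mat B. z ^ p)"
    using B(1) upper_triangular_pow[OF B(1,2), of p]
    by (simp add: mat_trace_def diag_mat_def comp_def interv_sum_list_conv_sum_set_nat atLeast0LessThan)
  finally show "mat_trace (A ^\<^sub>m p) = (\<Sum>z\<in>#proots (char_poly A). z ^ p)"
    by (simp add: roots sum_mset_sum_list mset_map[symmetric] del: mset_map)
qed

section \<open>Adjoints and reality of the spectrum\<close>

lemma mat_adjoint_dim [simp]:
  "dim_row (mat_adjoint A) = dim_col A" "dim_col (mat_adjoint A) = dim_row A"
  by (simp_all add: mat_adjoint_def)

lemma mat_adjoint_carrier [simp]: "A \<in> carrier_mat n k \<Longrightarrow> mat_adjoint A \<in> carrier_mat k n"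
  by (auto simp: mat_adjoint_def)

lemma mat_adjoint_index:
  "A \<in> carrier_mat n k \<Longrightarrow> i < k \<Longrightarrow> j < n \<Longrightarrow> mat_adjoint A $$ (i, j) = conjugate (A $$ (j, i))"
  by (auto simp: mat_adjoint_def mat_of_rows_index)

lemma mat_adjoint_mult:
  fixes A B :: "complex mat"
  assumes "A \<in> carrier_mat n n" "B \<in> carrier_mat n n"
  shows "mat_adjoint (A * B) = mat_adjoint B * mat_adjoint A"
proof (rule eq_matI)
  fix i j assume "i < dim_row (mat_adjoint B * mat_adjoint A)" "j < dim_col (mat_adjoint B * mat_adjoint A)"
  hence ij: "i < n" "j < n" using assms by auto
  have "mat_adjoint (A * B) $$ (i, j) = cnj ((A * B) $$ (j, i))"
    using mat_adjoint_index[of "A * B" n n i j] assms ij by simp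
  also have "\<dots> = (\<Sum>k<n. mat_adjoint B $$ (i, k) * mat_adjoint A $$ (k, j))"
    using assms ij by (simp add: index_mult_mat_sum[where n = n] mat_adjoint_index[of _ n n] mult.commute del: index_mult_mat(1))
  also have "\<dots> = (mat_adjoint B * mat_adjoint A) $$ (i, j)"
    using assms ij by (simp add: index_mult_mat_sum[where n = n] del: index_mult_mat(1))
  finally show "mat_adjoint (A * B) $$ (i, j) = (mat_adjoint B * mat_adjoint A) $$ (i, j)" .
qed (use assms in auto)

lemma mat_adjoint_adjoint:
  fixes A :: "complex mat"
  assumes "A \<in> carrier_mat n n"
  shows "mat_adjoint (mat_adjoint A) = A"
  using assms by (intro eq_matI) (auto simp: mat_adjoint_index[of _ n n])

lemma pow_mat_Suc_left:
  assumes "A \<in> carrier_mat n n"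
  shows "A ^\<^sub>m Suc k = A * A ^\<^sub>m k"
proof (induction k)
  case (Suc k)
  have "A ^\<^sub>m Suc (Suc k) = A * A ^\<^sub>m k * A" using Suc by simp
  also have "\<dots> = A * A ^\<^sub>m Suc k" using assms by (simp add: assoc_mult_mat[of _ n n _ n _ n])
  finally show ?case .
qed (use assms in auto)

lemma mat_adjoint_pow:
  fixes A :: "complex mat"
  assumes "A \<in> carrier_mat n n"
  shows "mat_adjoint (A ^\<^sub>m k) = mat_adjoint A ^\<^sub>m k"
proof (induction k)
  case 0
  show ?case using assms by (auto intro!: eq_matI simp: mat_adjoint_index[of _ n n])
next
  case (Suc k)
  show ?case
    unfolding pow_mat.simps(2)[of A] mat_adjoint_mult[OF pow_carrier_mat[OF assms] assms] Suc
    by (rule pow_mat_Suc_left[OF mat_adjoint_carrier[OF assms], symmetric])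
qed

text \<open>For an eigenvector \<open>v\<close> the quadratic form \<open>q\<close> equals both its
  own conjugate and z times the positive number |v|^2.\<close>

lemma hermitian_proots_real:
  fixes A :: "complex mat"
  assumes A: "A \<in> carrier_mat n n" and herm: "mat_adjoint A = A" and z: "z \<in># proots (char_poly A)"
  shows "Im z = 0"
proof -
  have "char_poly A \<noteq> 0" using degree_monic_char_poly[OF A] by auto
  hence "poly (char_poly A) z = 0" using z by simp
  then obtain v where v: "eigenvector A v z"
    using eigenvalue_root_char_poly[OF A] by (auto simp: eigenvalue_def)
  hence vn: "v \<in> carrier_vec n" "v \<noteq> 0\<^sub>v n" "A *\<^sub>v v = z \<cdot>\<^sub>v v"
    using A by (auto simp: eigenvector_def)
  have Av: "(\<Sum>j<n. A $$ (i, j) * v $ j) = z * v $ i" if "i < n" for i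
  proof -
    have "(A *\<^sub>v v) $ i = (\<Sum>j<n. A $$ (i, j) * v $ j)"
      using that A vn(1) by (simp add: scalar_prod_def atLeast0LessThan)
    thus ?thesis using vn that by simp
  qed
  define q where "q = (\<Sum>i<n. \<Sum>j<n. cnj (v $ i) * (A $$ (i, j) * v $ j))"
  define s where "s = (\<Sum>i<n. (cmod (v $ i))\<^sup>2)"
  have "cnj q = (\<Sum>i<n. \<Sum>j<n. cnj (v $ j) * (A $$ (j, i) * v $ i))"
  proof -
    have "cnj (A $$ (i, j)) = A $$ (j, i)" if "i < n" "j < n" for i j
      using mat_adjoint_index[OF A that(2,1)] herm by simp
    thus ?thesis by (simp add: q_def mult_ac)
  qed
  hence "cnj q = q" unfolding q_def by (subst (2) sum.swap) simp
  moreover have "q = z * complex_of_real s"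
  proof -
    have "complex_of_real s = (\<Sum>i<n. v $ i * cnj (v $ i))"
      unfolding s_def of_real_sum complex_norm_square ..
    moreover have "q = (\<Sum>i<n. cnj (v $ i) * (z * v $ i))"
      by (simp add: q_def sum_distrib_left[symmetric] Av)
    ultimately show ?thesis by (simp add: sum_distrib_left mult_ac)
  qed
  moreover have "s > 0"
  proof -
    obtain i where "i < n" "v $ i \<noteq> 0" using vn(1,2) by (metis eq_vecI carrier_vecD index_zero_vec)
    thus ?thesis unfolding s_def by (intro sum_pos2[of _ i]) auto
  qed
  ultimately show ?thesis by (auto simp: complex_eq_iff)
qed

text \<open>The empirical eigenvalue distribution as a monotone functional of test functions, so
  that the indicator in \<open>eigenvalue_cdf\<close> can be compared with polynomials.\<close>

definition spectral_mean :: "complex mat \<Rightarrow> (real \<Rightarrow> real) \<Rightarrow> real" where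
  "spectral_mean A f = (\<Sum>z\<in>#proots (char_poly A). f (Re z)) / real (dim_row A)"

lemma eigenvalue_cdf_spectral_mean: "eigenvalue_cdf A t = spectral_mean A (\<lambda>x. of_bool (x \<le> t))"
  by (simp add: eigenvalue_cdf_def spectral_mean_def)

lemma spectral_mean_mono: "(\<And>x. f x \<le> g x) \<Longrightarrow> spectral_mean A f \<le> spectral_mean A g"
  unfolding spectral_mean_def by (intro divide_right_mono sum_mset_mono) auto

lemma spectral_mean_bound:
  assumes "A \<in> carrier_mat n n" "\<And>x. 0 \<le> f x" "\<And>x. f x \<le> 1"
  shows "0 \<le> spectral_mean A f" "spectral_mean A f \<le> 1"
proof -
  have "(\<Sum>z\<in>#M. f (Re z)) \<le> real (size M)" "(\<Sum>z\<in>#M. f (Re z)) \<ge> 0" for M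
    by (induction M) (auto intro: add_mono assms add_nonneg_nonneg)
  from this[of "proots (char_poly A)"] show "0 \<le> spectral_mean A f" "spectral_mean A f \<le> 1"
    using mat_trace_pow_proots(2)[OF assms(1)] assms(1)
    by (auto simp: spectral_mean_def divide_le_eq)
qed

lemma spectral_mean_tendsto:
  assumes "\<And>x. (\<lambda>k. f k x) \<longlonglongrightarrow> g x"
  shows "(\<lambda>k. spectral_mean A (f k)) \<longlonglongrightarrow> spectral_mean A g"
proof -
  have "(\<lambda>k. \<Sum>z\<in>#M. f k (Re z)) \<longlonglongrightarrow> (\<Sum>z\<in>#M. g (Re z))" for M
    by (induction M) (auto intro!: tendsto_add assms)
  thus ?thesis unfolding spectral_mean_def by (auto intro!: tendsto_intros simp: divide_inverse)
qed

text \<open>The trace controls \<open>Re (z ^ k)\<close>, whereas the spectral mean involves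
  \<open>Re z ^ k\<close>; they agree because the eigenvalues are real.\<close>

lemma spectral_mean_poly:
  assumes A: "A \<in> carrier_mat n n" and herm: "mat_adjoint A = A"
  shows "spectral_mean A (poly p) = (\<Sum>k\<le>degree p. coeff p k * (Re (mat_trace (A ^\<^sub>m k)) / real n))"
proof -
  have Re_pow: "Re (z ^ k) = Re z ^ k" if "z \<in># proots (char_poly A)" for z k
  proof -
    have "z = complex_of_real (Re z)"
      using hermitian_proots_real[OF A herm that] by (simp add: complex_eq_iff)
    thus ?thesis by (metis Re_complex_of_real of_real_power)
  qed
  have Re_sum: "Re (\<Sum>z\<in>#M. z ^ k) = (\<Sum>z\<in>#M. Re (z ^ k))" for M :: "complex multiset" and k
    by (induction M) auto
  have tr: "Re (mat_trace (A ^\<^sub>m k)) = (\<Sum>z\<in>#proots (char_poly A). Re z ^ k)" for k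
    unfolding mat_trace_pow_proots(1)[OF A] Re_sum using Re_pow by (metis (mono_tags, lifting) image_mset_cong)
  have "(\<Sum>z\<in>#M. poly p (Re z)) = (\<Sum>k\<le>degree p. coeff p k * (\<Sum>z\<in>#M. Re z ^ k))" for M :: "complex multiset"
    by (induction M) (auto simp: poly_altdef algebra_simps sum.distrib)
  thus ?thesis using A
    by (simp add: spectral_mean_def tr sum_divide_distrib)
qed

section \<open>Words in a matrix and its adjoint as sums over walks\<close>

definition word_mat :: "complex mat \<Rightarrow> bool list \<Rightarrow> complex mat" where
  "word_mat X w = foldr (\<lambda>a B. (if a then X else mat_adjoint X) * B) w (1\<^sub>m (dim_row X))"

lemma word_mat_carrier [simp]: "X \<in> carrier_mat n n \<Longrightarrow> word_mat X w \<in> carrier_mat n n"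
  unfolding word_mat_def by (induction w) (auto intro!: mult_carrier_mat[of _ n n])

lemma word_mat_simps:
  "word_mat X [] = 1\<^sub>m (dim_row X)"
  "word_mat X (a # w) = (if a then X else mat_adjoint X) * word_mat X w"
  by (simp_all add: word_mat_def)

lemma word_mat_append:
  assumes X: "X \<in> carrier_mat n n"
  shows "word_mat X (v @ w) = word_mat X v * word_mat X w"
proof (induction v)
  case Nil
  show ?case using left_mult_one_mat[OF word_mat_carrier[OF X, of w]] X by (simp add: word_mat_simps)
next
  case (Cons a v)
  have "(if a then X else mat_adjoint X) \<in> carrier_mat n n" using X by simp
  thus ?case using Cons assoc_mult_mat[OF _ word_mat_carrier[OF X] word_mat_carrier[OF X]]
    by (simp add: word_mat_simps)
qed

lemma word_mat_replicate:
  assumes X: "X \<in> carrier_mat n n"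
  shows "word_mat X (replicate k a) = (if a then X else mat_adjoint X) ^\<^sub>m k"
proof (induction k)
  case 0
  show ?case using X by (auto simp: word_mat_simps)
next
  case (Suc k)
  have "(if a then X else mat_adjoint X) \<in> carrier_mat n n" using X by simp
  thus ?case using Suc by (simp add: word_mat_simps pow_mat_Suc_left del: pow_mat.simps)
qed

lemma word_mat_concat_replicate:
  assumes X: "X \<in> carrier_mat n n"
  shows "word_mat X (concat (replicate k w)) = word_mat X w ^\<^sub>m k"
proof (induction k)
  case 0
  show ?case using carrier_matD(1)[OF word_mat_carrier[OF X, of w]] X by (simp add: word_mat_simps)
next
  case (Suc k)
  thus ?case
    using pow_mat_Suc_left[OF word_mat_carrier[OF X]] by (simp add: word_mat_append[OF X] del: pow_mat.simps)
qed

definition walk_weight :: "('v \<times> 'v \<Rightarrow> complex) \<Rightarrow> bool list \<Rightarrow> ('v \<times> 'v) list \<Rightarrow> complex" where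
  "walk_weight Y w es = (\<Prod>(a, e)\<leftarrow>zip w es. if a then Y e else cnj (Y e))"

text \<open>The product is expanded over the intermediate indices. The list holds the vertices after
  the start, hence the end is \<open>last (i # ks)\<close>, which is \<open>i\<close> for the empty
  word.\<close>

lemma word_mat_index:
  assumes X: "X \<in> carrier_mat n n" and "i < n" "j < n"
  shows "word_mat X w $$ (i, j) =
    (\<Sum>ks | length ks = length w \<and> set ks \<subseteq> {..<n} \<and> last (i # ks) = j.
        walk_weight (($$) X) w (walk_edges i w ks))"
  using assms(2)
proof (induction w arbitrary: i)
  case Nil
  have "{ks. length ks = length [] \<and> set ks \<subseteq> {..<n} \<and> last (i # ks) = j} = (if i = j then {[]} else {})"
    by auto
  thus ?case using X Nil assms(3) by (simp add: word_mat_simps walk_weight_def)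
next
  case (Cons a w)
  let ?Y = "if a then X else mat_adjoint X"
  have "word_mat X (a # w) $$ (i, j) = (\<Sum>k<n. ?Y $$ (i, k) * word_mat X w $$ (k, j))"
    unfolding word_mat_simps using X Cons.prems assms(3)
    by (intro index_mult_mat_sum) auto
  also have "\<dots> = (\<Sum>k<n. \<Sum>ks | length ks = length w \<and> set ks \<subseteq> {..<n} \<and> last (i # k # ks) = j.
      walk_weight (($$) X) (a # w) (walk_edges i (a # w) (k # ks)))"
    using X Cons.prems
    by (intro sum.cong) (auto simp: Cons.IH sum_distrib_left walk_weight_def mat_adjoint_index[OF X])
  also have "\<dots> = (\<Sum>ks | length ks = length (a # w) \<and> set ks \<subseteq> {..<n} \<and> last (i # ks) = j.
        walk_weight (($$) X) (a # w) (walk_edges i (a # w) ks))"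
    unfolding list.size add_Suc_right add_0_right by (rule sum_Cons_lists[symmetric]) simp
  finally show ?case .
qed

lemma mat_trace_word_mat:
  assumes X: "X \<in> carrier_mat n n"
  shows "mat_trace (word_mat X w) =
    (\<Sum>i<n. \<Sum>ks | length ks = length w \<and> set ks \<subseteq> {..<n} \<and> last (i # ks) = i.
        walk_weight (($$) X) w (walk_edges i w ks))"
  using word_mat_carrier[OF X, of w] by (simp add: mat_trace_def word_mat_index[OF X])

lemma power_product_word_mat:
  assumes X: "X \<in> carrier_mat n n"
  shows "(X ^\<^sub>m m * mat_adjoint X ^\<^sub>m m) ^\<^sub>m p
    = word_mat X (concat (replicate p (replicate m True @ replicate m False)))"
  unfolding word_mat_concat_replicate[OF X] word_mat_append[OF X] word_mat_replicate[OF X] by simp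

lemma power_product_hermitian:
  fixes X :: "complex mat"
  assumes X: "X \<in> carrier_mat n n"
  shows "mat_adjoint (X ^\<^sub>m m * mat_adjoint X ^\<^sub>m m) = X ^\<^sub>m m * mat_adjoint X ^\<^sub>m m"
  using X by (simp add: mat_adjoint_mult[of _ n] mat_adjoint_pow[of _ n] mat_adjoint_adjoint[of _ n])

section \<open>The Fuss--Catalan distribution\<close>

lemma weierstrass_poly:
  fixes f :: "real \<Rightarrow> real"
  assumes "continuous_on {a..b} f" "0 < e"
  obtains p :: "real poly" where "\<And>x. x \<in> {a..b} \<Longrightarrow> \<bar>f x - poly p x\<bar> < e"
proof -
  obtain g where g: "real_polynomial_function g" "\<And>x. x \<in> {a..b} \<Longrightarrow> \<bar>f x - g x\<bar> < e"
    using Stone_Weierstrass_real_polynomial_function[OF compact_Icc assms] by blast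
  obtain c n where c: "g = (\<lambda>x. \<Sum>i\<le>n. c i * x ^ i)"
    using real_polynomial_function_imp_sum[OF g(1)] by blast
  have "poly (\<Sum>i\<le>n. monom (c i) i) x = g x" for x by (simp add: c poly_sum poly_monom)
  with g(2) show ?thesis by (intro that[of "\<Sum>i\<le>n. monom (c i) i"]) simp
qed

lemma cts_step_bounds: "a < b \<Longrightarrow> 0 \<le> cts_step a b x" "a < b \<Longrightarrow> cts_step a b x \<le> 1"
  by (auto simp: cts_step_def)

lemma cts_step_continuous: "a < b \<Longrightarrow> continuous_on S (cts_step a b)"
  using cts_step_uniformly_continuous uniformly_continuous_imp_continuous continuous_on_subset by blast

text \<open>Serves for measurability only, so pointwise convergence suffices: ramps of width
  \<open>d n\<close> are approximated within \<open>d n\<close> on intervals growing to the whole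
  line.\<close>

lemma poly_tendsto_of_bool_le:
  obtains P :: "nat \<Rightarrow> real poly" where "\<And>x. (\<lambda>n. poly (P n) x) \<longlonglongrightarrow> of_bool (x \<le> t)"
proof -
  define d where "d n = 1 / real (Suc n)" for n
  define f where "f n = cts_step t (t + d n)" for n
  have d: "d n > 0" for n by (simp add: d_def)
  have "\<exists>p. \<forall>x\<in>{- real n..real n}. \<bar>f n x - poly p x\<bar> < d n" for n
    using weierstrass_poly[of "- real n" "real n" "f n" "d n"] d[of n]
    by (metis cts_step_continuous f_def less_add_same_cancel1)
  then obtain P where P: "\<And>n x. x \<in> {- real n..real n} \<Longrightarrow> \<bar>f n x - poly (P n) x\<bar> < d n"
    by metis
  show ?thesis
  proof (rule that[of P])
    fix x
    have d0: "d \<longlonglongrightarrow> 0" unfolding d_def by (rule lim_1_over_real_power[of 1, simplified] LIMSEQ_Suc lim_1_over_n)+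
    have "(\<lambda>n. f n x) \<longlonglongrightarrow> of_bool (x \<le> t)"
    proof (rule tendsto_eventually)
      have "eventually (\<lambda>n. x > t \<longrightarrow> d n < x - t) sequentially"
        using order_tendstoD(2)[OF d0, of "x - t"] by (cases "x > t") (auto elim: eventually_mono)
      thus "eventually (\<lambda>n. f n x = of_bool (x \<le> t)) sequentially"
        by eventually_elim (auto simp: f_def cts_step_def)
    qed
    moreover have "(\<lambda>n. poly (P n) x - f n x) \<longlonglongrightarrow> 0"
    proof (rule Lim_null_comparison[OF _ d0])
      have "eventually (\<lambda>n. \<bar>x\<bar> \<le> real n) sequentially"
        by (rule eventually_ge_at_top[THEN eventually_compose_filterlim, OF filterlim_real_sequentially])
      thus "eventually (\<lambda>n. norm (poly (P n) x - f n x) \<le> d n) sequentially"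
      proof eventually_elim
        case (elim n)
        thus ?case using P[of x n] by (auto simp: abs_le_iff)
      qed
    qed
    ultimately have "(\<lambda>n. f n x + (poly (P n) x - f n x)) \<longlonglongrightarrow> of_bool (x \<le> t) + 0"
      by (rule tendsto_add)
    thus "(\<lambda>n. poly (P n) x) \<longlonglongrightarrow> of_bool (x \<le> t)" by simp
  qed
qed

text \<open>A high even power \<open>(x / (2 * K)) ^ (2 * k)\<close> is negligible on \<open>[-K, K]\<close> and dominates a
  given polynomial outside \<open>[-2 * K, 2 * K]\<close>.\<close>

lemma poly_sandwich:
  fixes f :: "real \<Rightarrow> real"
  assumes K: "K > 0" and f: "continuous_on UNIV f" "\<And>x. 0 \<le> f x" "\<And>x. f x \<le> 1" and e: "e > 0"
  shows "\<exists>p q. (\<forall>x. poly p x \<le> f x \<and> f x \<le> poly q x) \<and>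
    (\<forall>x. \<bar>x\<bar> \<le> K \<longrightarrow> poly q x \<le> f x + e \<and> f x - e \<le> poly p x)"
proof -
  define B where "B = 2 * K"
  have B: "B > 0" using K by (simp add: B_def)
  have fB: "continuous_on {-B..B} f" using f(1) continuous_on_subset by blast
  have "e / 3 > 0" using e by simp
  then obtain r where r: "\<And>x. x \<in> {-B..B} \<Longrightarrow> \<bar>f x - poly r x\<bar> < e / 3"
    using weierstrass_poly[OF fB] by blast
  define C' where "C' = (\<Sum>i\<le>degree r. \<bar>coeff r i\<bar> * B ^ i)"
  have C': "C' \<ge> 0" unfolding C'_def using B by (intro sum_nonneg) auto
  \<comment> \<open>The extra 1 lifts the upper polynomial above 1, and thus above \<open>f\<close>,
    outside [-B, B].\<close>
  define C where "C = C' + 1"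
  have "(\<lambda>k. C * (1 / 4) ^ k) \<longlonglongrightarrow> C * 0"
    by (intro tendsto_mult tendsto_const LIMSEQ_power_zero) simp
  hence "eventually (\<lambda>k. C * (1 / 4) ^ k < e / 3) sequentially"
    using e by (intro order_tendstoD(2)[of _ 0]) auto
  then obtain k where k: "C * (1 / 4) ^ k < e / 3" "k \<ge> degree r"
    using eventually_happens[OF eventually_conj[OF _ eventually_ge_at_top[of "degree r"]]] by fastforce
  define h where "h = monom (C / B ^ (2 * k)) (2 * k)"
  have h: "poly h x = C * (\<bar>x\<bar> / B) ^ (2 * k)" for x
    by (simp add: h_def poly_monom power_divide power_mult)
  have h0: "poly h x \<ge> 0" for x unfolding h using C' B by (simp add: C_def)
  have hK: "poly h x \<le> e / 3" if "\<bar>x\<bar> \<le> K" for x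
  proof -
    have "(\<bar>x\<bar> / B) ^ (2 * k) \<le> (1 / 2) ^ (2 * k)"
      using that K by (intro power_mono) (auto simp: B_def field_simps)
    also have "\<dots> = (1 / 4) ^ k" by (simp add: power_mult power2_eq_square)
    finally have "poly h x \<le> C * (1 / 4) ^ k" unfolding h using C' by (intro mult_left_mono) (auto simp: C_def)
    thus ?thesis using k(1) by simp
  qed
  have rB: "\<bar>poly r x\<bar> + 1 \<le> poly h x" if x: "\<bar>x\<bar> > B" for x
  proof -
    have q: "\<bar>x\<bar> / B \<ge> 1" using x B by simp
    have "\<bar>poly r x\<bar> \<le> (\<Sum>i\<le>degree r. \<bar>coeff r i * x ^ i\<bar>)"
      unfolding poly_altdef by (rule sum_abs)
    also have "\<dots> \<le> (\<Sum>i\<le>degree r. \<bar>coeff r i\<bar> * B ^ i * (\<bar>x\<bar> / B) ^ (2 * k))"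
    proof (rule sum_mono)
      fix i assume "i \<in> {..degree r}"
      hence "i \<le> 2 * k" using k(2) by simp
      hence "(\<bar>x\<bar> / B) ^ i \<le> (\<bar>x\<bar> / B) ^ (2 * k)" using q by (rule power_increasing)
      hence "\<bar>coeff r i\<bar> * B ^ i * (\<bar>x\<bar> / B) ^ i \<le> \<bar>coeff r i\<bar> * B ^ i * (\<bar>x\<bar> / B) ^ (2 * k)"
        using B by (intro mult_left_mono) auto
      thus "\<bar>coeff r i * x ^ i\<bar> \<le> \<bar>coeff r i\<bar> * B ^ i * (\<bar>x\<bar> / B) ^ (2 * k)"
        using B by (simp add: abs_mult power_abs power_divide)
    qed
    also have "\<dots> = C' * (\<bar>x\<bar> / B) ^ (2 * k)" by (simp add: C'_def sum_distrib_right)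
    finally have "\<bar>poly r x\<bar> \<le> C' * (\<bar>x\<bar> / B) ^ (2 * k)" .
    moreover have "1 \<le> (\<bar>x\<bar> / B) ^ (2 * k)" using q by (rule one_le_power)
    ultimately show ?thesis unfolding h C_def by (simp add: algebra_simps)
  qed
  have ev: "poly (r - [:e / 3:] - h) x = poly r x - e / 3 - poly h x"
    "poly (r + [:e / 3:] + h) x = poly r x + e / 3 + poly h x" for x
    by simp_all
  have P: "poly (r - [:e / 3:] - h) x \<le> f x \<and> f x \<le> poly (r + [:e / 3:] + h) x" for x
  proof (cases "\<bar>x\<bar> \<le> B")
    case True
    hence "\<bar>f x - poly r x\<bar> < e / 3" by (intro r) auto
    thus ?thesis unfolding ev using h0[of x] by linarith
  next
    case False
    hence "\<bar>poly r x\<bar> + 1 \<le> poly h x" by (intro rB) auto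
    thus ?thesis unfolding ev using f(2,3)[of x] e by linarith
  qed
  have Q: "poly (r + [:e / 3:] + h) x \<le> f x + e \<and> f x - e \<le> poly (r - [:e / 3:] - h) x" if "\<bar>x\<bar> \<le> K" for x
  proof -
    have "\<bar>f x - poly r x\<bar> < e / 3" using that K by (intro r) (auto simp: B_def)
    thus ?thesis unfolding ev using hK[OF that] by linarith
  qed
  show ?thesis using P Q by (intro exI[of _ "r - [:e / 3:] - h"] exI[of _ "r + [:e / 3:] + h"]) simp
qed

lemma (in real_distribution) bounded_integrable_poly:
  assumes "AE x in M. \<bar>x\<bar> \<le> K"
  shows "integrable M (poly p)"
proof (rule integrable_const_bound)
  show "AE x in M. norm (poly p x) \<le> (\<Sum>i\<le>degree p. \<bar>coeff p i\<bar> * K ^ i)"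
    using assms
  proof eventually_elim
    case (elim x)
    have "\<bar>poly p x\<bar> \<le> (\<Sum>i\<le>degree p. \<bar>coeff p i * x ^ i\<bar>)"
      unfolding poly_altdef by (rule sum_abs)
    also have "\<dots> \<le> (\<Sum>i\<le>degree p. \<bar>coeff p i\<bar> * K ^ i)"
      using elim by (intro sum_mono) (auto simp: abs_mult power_abs intro!: mult_left_mono power_mono)
    finally show ?case by simp
  qed
  have "poly p \<in> borel_measurable borel" by (intro borel_measurable_continuous_onI continuous_intros)
  thus "poly p \<in> borel_measurable M" by simp
qed

text \<open>Half of \<open>e\<close> pays for a ramp on either side of \<open>t\<close>, over which
  \<open>cdf M\<close> changes little by continuity, and half for the polynomials. The integral
  bounds use the bounded support of \<open>M\<close>, but the pointwise ones hold on the whole line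
  and can be integrated against any measure with moments.\<close>

lemma (in real_distribution) poly_sandwich_of_bool_le:
  assumes K: "K > 0" "AE x in M. \<bar>x\<bar> \<le> K" and t: "isCont (cdf M) t" and e: "e > 0"
  obtains p q :: "real poly" where
    "\<And>x. poly p x \<le> of_bool (x \<le> t)" "\<And>x. of_bool (x \<le> t) \<le> poly q x"
    "cdf M t - e \<le> (\<integral>x. poly p x \<partial>M)" "(\<integral>x. poly q x \<partial>M) \<le> cdf M t + e"
proof -
  have "e / 2 > 0" using e by simp
  with t obtain d where d: "d > 0" "\<And>y. \<bar>y - t\<bar> < d \<Longrightarrow> \<bar>cdf M y - cdf M t\<bar> < e / 2"
    unfolding continuous_at_eps_delta dist_real_def by blast
  define a where "a = t - d / 2"
  define b where "b = t + d / 2"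
  have ab: "a < t" "t < b" using d(1) by (auto simp: a_def b_def)
  from poly_sandwich[OF K(1) cts_step_continuous[OF ab(1)] cts_step_bounds[OF ab(1)] \<open>e / 2 > 0\<close>]
  obtain p where p: "poly p x \<le> cts_step a t x" "\<bar>x\<bar> \<le> K \<Longrightarrow> cts_step a t x - e / 2 \<le> poly p x" for x
    by metis
  from poly_sandwich[OF K(1) cts_step_continuous[OF ab(2)] cts_step_bounds[OF ab(2)] \<open>e / 2 > 0\<close>]
  obtain q where q: "cts_step t b x \<le> poly q x" "\<bar>x\<bar> \<le> K \<Longrightarrow> poly q x \<le> cts_step t b x + e / 2" for x
    by metis
  show ?thesis
  proof (rule that[of p q])
    show "poly p x \<le> of_bool (x \<le> t)" for x
      using p(1)[of x] cts_step_bounds(2)[OF ab(1), of x] ab by (auto simp: cts_step_def split: if_splits)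
    show "of_bool (x \<le> t) \<le> poly q x" for x
      using q(1)[of x] cts_step_bounds(1)[OF ab(2), of x] by (auto simp: cts_step_def split: if_splits)
    have "\<bar>cdf M a - cdf M t\<bar> < e / 2" by (rule d(2)) (use d(1) in \<open>simp add: a_def\<close>)
    hence "cdf M t - e \<le> cdf M a - e / 2" by linarith
    also have "\<dots> \<le> (\<integral>x. cts_step a t x \<partial>M) - e / 2" using cdf_cts_step(1)[OF ab(1)] by simp
    also have "\<dots> = (\<integral>x. cts_step a t x - e / 2 \<partial>M)"
      using integrable_cts_step[OF ab(1)] prob_space by simp
    also have "\<dots> \<le> (\<integral>x. poly p x \<partial>M)"
      using K(2) by (intro integral_mono_AE bounded_integrable_poly[OF K(2)] Bochner_Integration.integrable_diff
        integrable_cts_step[OF ab(1)]) (auto intro: p(2))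
    finally show "cdf M t - e \<le> (\<integral>x. poly p x \<partial>M)" .
    have "(\<integral>x. poly q x \<partial>M) \<le> (\<integral>x. cts_step t b x + e / 2 \<partial>M)"
      using K(2) by (intro integral_mono_AE bounded_integrable_poly[OF K(2)] Bochner_Integration.integrable_add
        integrable_cts_step[OF ab(2)]) (auto intro: q(2))
    also have "\<dots> = (\<integral>x. cts_step t b x \<partial>M) + e / 2"
      using integrable_cts_step[OF ab(2)] prob_space by simp
    also have "\<dots> \<le> cdf M b + e / 2" using cdf_cts_step(2)[OF ab(2)] by simp
    also have "\<dots> \<le> cdf M t + e"
    proof -
      have "\<bar>cdf M b - cdf M t\<bar> < e / 2" by (rule d(2)) (use d(1) in \<open>simp add: b_def\<close>)
      thus ?thesis by linarith
    qed
    finally show "(\<integral>x. poly q x \<partial>M) \<le> cdf M t + e" .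
  qed
qed

lemma has_bochner_integral_poly:
  fixes \<mu> :: "real measure"
  assumes "\<And>k. has_bochner_integral \<mu> (\<lambda>x. x ^ k) (s k)"
  shows "has_bochner_integral \<mu> (poly p) (\<Sum>k\<le>degree p. coeff p k * s k)"
proof -
  have "poly p = (\<lambda>x. \<Sum>k\<le>degree p. coeff p k * x ^ k)" by (rule ext) (rule poly_altdef)
  thus ?thesis by (auto intro!: has_bochner_integral_sum has_bochner_integral_mult_right assms)
qed

text \<open>Only \<open>G\<close> is known to be bounded. The polynomials around the indicator are
  global and have equal integrals under both measures, so they also pin down the distribution
  function of \<open>\<mu>\<close>.\<close>

lemma bounded_moments_unique:
  assumes "real_distribution G" "K > 0" "AE x in G. \<bar>x\<bar> \<le> K" "\<And>x. measure G {x} = 0"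
    and "\<And>k. has_bochner_integral G (\<lambda>x. x ^ k) (s k)"
    and "real_distribution \<mu>" "\<And>k. has_bochner_integral \<mu> (\<lambda>x. x ^ k) (s k)"
  shows "\<mu> = G"
proof (rule cdf_unique[OF assms(6,1)], rule ext)
  fix t
  interpret G: real_distribution G by fact
  interpret \<mu>: real_distribution \<mu> by fact
  have poly_eq: "(\<integral>x. poly p x \<partial>\<mu>) = (\<integral>x. poly p x \<partial>G)" "integrable \<mu> (poly p)" for p
    using has_bochner_integral_poly[OF assms(5), of p] has_bochner_integral_poly[OF assms(7), of p]
    by (auto simp: has_bochner_integral_iff)
  have cdf_\<mu>: "cdf \<mu> t = (\<integral>x. of_bool (x \<le> t) \<partial>\<mu>)"
  proof -
    have "(\<lambda>x. of_bool (x \<le> t)) = (indicator {..t} :: real \<Rightarrow> real)" by (auto simp: indicator_def)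
    thus ?thesis by (simp add: cdf_def)
  qed
  have int: "integrable \<mu> (\<lambda>x. of_bool (x \<le> t) :: real)"
    by (rule \<mu>.integrable_const_bound[of _ 1]) auto
  have "\<bar>cdf \<mu> t - cdf G t\<bar> \<le> e" if e: "e > 0" for e
  proof -
    have "isCont (cdf G) t" using assms(4) G.isCont_cdf by simp
    then obtain p q where pq: "\<And>x. poly p x \<le> of_bool (x \<le> t)" "\<And>x. of_bool (x \<le> t) \<le> poly q x"
      "cdf G t - e \<le> (\<integral>x. poly p x \<partial>G)" "(\<integral>x. poly q x \<partial>G) \<le> cdf G t + e"
      using G.poly_sandwich_of_bool_le[OF assms(2,3) _ e] by blast
    have "(\<integral>x. poly p x \<partial>\<mu>) \<le> cdf \<mu> t" "cdf \<mu> t \<le> (\<integral>x. poly q x \<partial>\<mu>)"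
      unfolding cdf_\<mu> by (intro integral_mono poly_eq int pq)+
    thus ?thesis using pq(3,4) poly_eq(1) by (simp add: abs_le_iff)
  qed
  hence "\<bar>cdf \<mu> t - cdf G t\<bar> \<le> 0" by (rule field_le_epsilon) simp
  thus "cdf \<mu> t = cdf G t" by simp
qed

section \<open>Beta distributions and their independent products\<close>

definition beta_density :: "real \<Rightarrow> real \<Rightarrow> real \<Rightarrow> real" where
  "beta_density a b x = indicator {0..1} x * (x powr (a - 1) * (1 - x) powr (b - 1)) / Beta a b"

definition beta_measure :: "real \<Rightarrow> real \<Rightarrow> real measure" where
  "beta_measure a b = density lborel (beta_density a b)"

lemma Beta_real_pos: "a > 0 \<Longrightarrow> b > 0 \<Longrightarrow> Beta a (b::real) > 0"
  by (simp add: Beta_def)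

lemma beta_density_nonneg: "a > 0 \<Longrightarrow> b > 0 \<Longrightarrow> beta_density a b x \<ge> 0"
  using Beta_real_pos[of a b] by (auto simp: beta_density_def indicator_def)

lemma borel_measurable_beta_density [measurable]: "beta_density a b \<in> borel_measurable borel"
  unfolding beta_density_def[abs_def] by measurable

lemma beta_moment:
  assumes ab: "a > 0" "b > 0"
  shows "has_bochner_integral lborel (\<lambda>x. beta_density a b x * x ^ k) (pochhammer a k / pochhammer (a + b) k)"
proof -
  have ak: "a + real k > 0" using ab by simp
  have "has_bochner_integral lborel
      (\<lambda>x. indicator {0..1} x *\<^sub>R (x powr (a + real k - 1) * (1 - x) powr (b - 1))) (Beta (a + real k) b)"
    using integrable_Beta[OF ak ab(2)] set_borel_integral_eq_integral(2)[OF integrable_Beta[OF ak ab(2)]]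
      integral_unique[OF has_integral_Beta_real[OF ak ab(2)]]
    by (simp add: has_bochner_integral_iff set_integrable_def set_lebesgue_integral_def)
  hence "has_bochner_integral lborel
      (\<lambda>x. indicator {0..1} x *\<^sub>R (x powr (a + real k - 1) * (1 - x) powr (b - 1)) / Beta a b) (Beta (a + real k) b / Beta a b)"
    by (rule has_bochner_integral_divide_zero)
  moreover have "indicator {0..1} x *\<^sub>R (x powr (a + real k - 1) * (1 - x) powr (b - 1)) / Beta a b
      = beta_density a b x * x ^ k" for x
  proof (cases "x > 0")
    case True
    hence "x powr (a + real k - 1) = x powr (a - 1) * x ^ k"
      by (simp add: powr_realpow[symmetric] powr_add[symmetric] algebra_simps)
    thus ?thesis by (simp add: beta_density_def)
  next
    case False
    \<comment> \<open>At 0 both sides vanish because \<open>0 powr y = 0\<close>; to the left of 0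
      the indicator vanishes.\<close>
    thus ?thesis by (cases "x = 0") (auto simp: beta_density_def indicator_def)
  qed
  moreover have "Beta (a + real k) b / Beta a b = pochhammer a k / pochhammer (a + b) k"
  proof -
    have "a \<notin> \<int>\<^sub>\<le>\<^sub>0" "a + b \<notin> \<int>\<^sub>\<le>\<^sub>0" using ab by (auto elim!: nonpos_Ints_cases)
    moreover have "Gamma a \<noteq> 0" "Gamma b \<noteq> 0" "Gamma (a + b) \<noteq> 0" "Gamma (a + b + real k) \<noteq> 0"
      using ab by (auto simp: Gamma_eq_zero_iff elim!: nonpos_Ints_cases)
    ultimately show ?thesis
      by (simp add: Beta_def pochhammer_Gamma field_simps add_ac)
  qed
  ultimately show ?thesis by simp
qed

text \<open>Absence of atoms is stated almost everywhere, because in this form it passes through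
  density, scaling and product measures.\<close>

definition moment_model :: "(nat \<Rightarrow> real) \<Rightarrow> real \<Rightarrow> real measure \<Rightarrow> bool" where
  "moment_model s K \<mu> \<longleftrightarrow> real_distribution \<mu> \<and> (\<forall>k. has_bochner_integral \<mu> (\<lambda>x. x ^ k) (s k)) \<and>
     (AE x in \<mu>. \<bar>x\<bar> \<le> K) \<and> (\<forall>c. AE x in \<mu>. x \<noteq> c)"

lemma moment_model_atomless:
  assumes "moment_model s K \<mu>"
  shows "measure \<mu> {c} = 0"
proof -
  interpret real_distribution \<mu> using assms by (simp add: moment_model_def)
  have "AE x in \<mu>. x \<noteq> c" using assms by (simp add: moment_model_def)
  hence "emeasure \<mu> {c} = 0" by (subst (asm) AE_iff_measurable[of "{c}"]) auto
  thus ?thesis by (simp add: measure_def)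
qed

lemma moment_model_beta:
  assumes ab: "a > 0" "b > 0"
  shows "moment_model (\<lambda>k. pochhammer a k / pochhammer (a + b) k) 1 (beta_measure a b)"
proof -
  note nn = beta_density_nonneg[OF ab]
  have "emeasure (beta_measure a b) UNIV = (\<integral>\<^sup>+x. beta_density a b x \<partial>lborel)"
    by (simp add: beta_measure_def emeasure_density)
  also have "\<dots> = ennreal 1"
    using beta_moment[OF ab, of 0] nn by (subst nn_integral_eq_integral) (auto simp: has_bochner_integral_iff)
  finally have "prob_space (beta_measure a b)"
    by (intro prob_spaceI) (simp add: beta_measure_def)
  hence 1: "real_distribution (beta_measure a b)"
    by (intro real_distribution.intro real_distribution_axioms.intro) (auto simp: beta_measure_def)
  have 2: "has_bochner_integral (beta_measure a b) (\<lambda>x. x ^ k) (pochhammer a k / pochhammer (a + b) k)" for k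
    unfolding beta_measure_def using beta_moment[OF ab, of k] nn
    by (intro has_bochner_integral_density) auto
  have 3: "AE x in beta_measure a b. \<bar>x\<bar> \<le> 1"
    unfolding beta_measure_def by (subst AE_density) (auto simp: beta_density_def indicator_def)
  have 4: "AE x in beta_measure a b. x \<noteq> c" for c
    unfolding beta_measure_def using AE_lborel_singleton[of c] by (subst AE_density) auto
  show ?thesis unfolding moment_model_def using 1 2 3 4 by blast
qed

lemma moment_model_scale:
  assumes "moment_model s K \<mu>" "c > 0"
  shows "moment_model (\<lambda>k. c ^ k * s k) (c * K) (distr \<mu> borel (\<lambda>x. c * x))"
proof -
  interpret real_distribution \<mu> using assms(1) by (simp add: moment_model_def)
  have "has_bochner_integral (distr \<mu> borel (\<lambda>x. c * x)) (\<lambda>x. x ^ k) (c ^ k * s k)" for k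
    using assms(1) unfolding moment_model_def
    by (intro has_bochner_integral_distr) (auto simp: power_mult_distrib intro!: has_bochner_integral_mult_right)
  moreover have "AE x in distr \<mu> borel (\<lambda>x. c * x). \<bar>x\<bar> \<le> c * K"
    using assms by (subst AE_distr_iff) (auto simp: moment_model_def abs_mult)
  moreover have "AE x in distr \<mu> borel (\<lambda>x. c * x). x \<noteq> d" for d
  proof (subst AE_distr_iff)
    have "AE x in \<mu>. x \<noteq> d / c" using assms(1) by (simp add: moment_model_def)
    thus "AE x in \<mu>. c * x \<noteq> d" by eventually_elim (use assms(2) in \<open>auto simp: field_simps\<close>)
  qed auto
  ultimately show ?thesis unfolding moment_model_def by (auto intro!: real_distribution_distr)
qed

lemma moment_model_mult:
  assumes \<mu>: "moment_model s 1 \<mu>" and \<nu>: "moment_model s' 1 \<nu>"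
  shows "moment_model (\<lambda>k. s k * s' k) 1 (distr (\<mu> \<Otimes>\<^sub>M \<nu>) borel (\<lambda>(x, y). x * y))"
proof -
  interpret \<mu>: real_distribution \<mu> using \<mu> by (simp add: moment_model_def)
  interpret \<nu>: real_distribution \<nu> using \<nu> by (simp add: moment_model_def)
  interpret P: pair_prob_space \<mu> \<nu> ..
  have sets [measurable_cong]: "sets (\<mu> \<Otimes>\<^sub>M \<nu>) = sets (borel \<Otimes>\<^sub>M borel)" by (intro sets_pair_measure_cong) auto
  let ?f = "\<lambda>(x, y). x * y :: real"
  have f [measurable]: "?f \<in> borel_measurable (\<mu> \<Otimes>\<^sub>M \<nu>)" by measurable
  have AE1: "AE z in \<mu> \<Otimes>\<^sub>M \<nu>. \<bar>?f z\<bar> \<le> 1"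
  proof (rule P.AE_pair_measure)
    have "AE x in \<mu>. \<bar>x\<bar> \<le> 1" "AE y in \<nu>. \<bar>y\<bar> \<le> 1" using \<mu> \<nu> by (auto simp: moment_model_def)
    thus "AE x in \<mu>. AE y in \<nu>. \<bar>?f (x, y)\<bar> \<le> 1"
      by (auto elim!: eventually_mono simp: abs_mult intro: mult_le_one)
  qed measurable
  have AE2: "AE z in \<mu> \<Otimes>\<^sub>M \<nu>. ?f z \<noteq> c" for c
  proof (rule P.AE_pair_measure)
    \<comment> \<open>The value x = 0 has to be excluded first, since there x * y is constant; for
      any other x the level \<open>c\<close> leaves a single value of y.\<close>
    have "AE x in \<mu>. x \<noteq> 0" using \<mu> by (simp add: moment_model_def)
    thus "AE x in \<mu>. AE y in \<nu>. ?f (x, y) \<noteq> c"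
    proof eventually_elim
      case (elim x)
      have "AE y in \<nu>. y \<noteq> c / x" using \<nu> by (simp add: moment_model_def)
      thus ?case by eventually_elim (use elim in \<open>auto simp: field_simps\<close>)
    qed
  qed measurable
  have int: "integrable (\<mu> \<Otimes>\<^sub>M \<nu>) (\<lambda>z. ?f z ^ k)" for k
    by (rule P.integrable_const_bound[of _ 1])
       (use AE1 in \<open>auto elim!: eventually_mono simp: power_abs intro: power_le_one\<close>)
  have "(\<integral>z. ?f z ^ k \<partial>(\<mu> \<Otimes>\<^sub>M \<nu>)) = s k * s' k" for k
  proof -
    have "(\<integral>z. ?f z ^ k \<partial>(\<mu> \<Otimes>\<^sub>M \<nu>)) = (\<integral>x. \<integral>y. ?f (x, y) ^ k \<partial>\<nu> \<partial>\<mu>)"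
      by (rule P.integral_fst'[OF int, symmetric])
    also have "\<dots> = (\<integral>x. x ^ k * s' k \<partial>\<mu>)"
      using \<nu> by (simp add: power_mult_distrib moment_model_def has_bochner_integral_iff)
    also have "\<dots> = s k * s' k" using \<mu> by (simp add: moment_model_def has_bochner_integral_iff)
    finally show ?thesis .
  qed
  hence "has_bochner_integral (distr (\<mu> \<Otimes>\<^sub>M \<nu>) borel ?f) (\<lambda>x. x ^ k) (s k * s' k)" for k
    using int by (intro has_bochner_integral_distr) (auto simp: has_bochner_integral_iff)
  moreover have "AE x in distr (\<mu> \<Otimes>\<^sub>M \<nu>) borel ?f. \<bar>x\<bar> \<le> 1"
    using AE1 by (subst AE_distr_iff) auto
  moreover have "AE x in distr (\<mu> \<Otimes>\<^sub>M \<nu>) borel ?f. x \<noteq> c" for c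
    using AE2[of c] by (subst AE_distr_iff) auto
  ultimately show ?thesis unfolding moment_model_def by (auto intro!: P.real_distribution_distr)
qed

text \<open>At least one factor is taken, because the empty product would be a point mass, which has
  an atom.\<close>

lemma moment_model_prod:
  assumes "\<And>j. j \<in> {1..Suc n} \<Longrightarrow> \<exists>\<mu>. moment_model (s j) 1 \<mu>"
  shows "\<exists>\<mu>. moment_model (\<lambda>k. \<Prod>j=1..Suc n. s j k) 1 \<mu>"
  using assms
proof (induction n)
  case (Suc n)
  then obtain \<mu> \<nu> where "moment_model (\<lambda>k. \<Prod>j=1..Suc n. s j k) 1 \<mu>" "moment_model (s (Suc (Suc n))) 1 \<nu>"
    by force
  from moment_model_mult[OF this] show ?case by auto
qed auto

section \<open>Fuss-Catalan numbers as moments of a scaled beta product\<close>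

lemma fuss_catalan_fact:
  "fuss_catalan m k = fact (Suc m * k) / (fact k * fact (m * k + 1))"
  by (simp add: fuss_catalan_def binomial_fact add.commute)

lemma fact_add_prod: "fact (n + m) = fact n * (\<Prod>j=1..m. real (n + j))"
  by (induction m) (auto simp: algebra_simps)

text \<open>Gauss multiplication, applied to the three factorials in the Fuss--Catalan number. The factors
  are moments of beta distributions, since \<open>j / (m + 1) < (j + 1) / m\<close>.\<close>

lemma fuss_catalan_beta:
  assumes m: "m \<ge> 1"
  shows "fuss_catalan m k = (real (Suc m) ^ Suc m / real m ^ m) ^ k *
    (\<Prod>j=1..m. pochhammer (real j / real (Suc m)) k / pochhammer (real (Suc j) / real m) k)"
proof (induction k)
  case 0
  show ?case by (simp add: fuss_catalan_def)
next
  case (Suc k)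
  let ?K = "real (Suc m) ^ Suc m / real m ^ m"
  define u where "u j = real (Suc m * k + j)" for j
  define v where "v j = real (m * k + 1 + j)" for j
  have v: "v j \<noteq> 0" for j unfolding v_def of_nat_eq_0_iff by simp
  have "Suc m * Suc k = Suc m * k + Suc m" "m * Suc k + 1 = (m * k + 1) + m" by auto
  hence "fuss_catalan m (Suc k) = fuss_catalan m k * ((\<Prod>j=1..Suc m. u j) / (real (Suc k) * (\<Prod>j=1..m. v j)))"
    unfolding fuss_catalan_fact u_def v_def by (simp only: fact_add_prod fact_Suc) (simp add: field_simps)
  \<comment> \<open>The last factor \<open>u (Suc m)\<close> is \<open>Suc m * Suc k\<close>; its
    \<open>Suc k\<close> cancels the one contributed by \<open>fact (Suc k)\<close>.\<close>
  also have "(\<Prod>j=1..Suc m. u j) = (\<Prod>j=1..m. u j) * (real (Suc m) * real (Suc k))"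
    by (simp add: u_def algebra_simps)
  also have "(\<Prod>j=1..m. u j) * (real (Suc m) * real (Suc k)) / (real (Suc k) * (\<Prod>j=1..m. v j))
      = real (Suc m) * (\<Prod>j=1..m. u j / v j)"
    by (simp add: prod_dividef field_simps del: of_nat_Suc)
  also have "\<dots> = ?K * (\<Prod>j=1..m. (real m / real (Suc m)) * (u j / v j))"
  proof -
    have "(\<Prod>j=1..m. (real m / real (Suc m)) * (u j / v j)) = (real m / real (Suc m)) ^ m * (\<Prod>j=1..m. u j / v j)"
      by (simp only: prod.distrib prod_constant card_atLeastAtMost diff_Suc_1)
    moreover have "?K * (real m / real (Suc m)) ^ m = real (Suc m)"
      using m by (simp add: power_divide del: of_nat_Suc)
    ultimately show ?thesis by (metis mult.assoc)
  qed
  also have "(\<Prod>j=1..m. (real m / real (Suc m)) * (u j / v j))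
      = (\<Prod>j=1..m. (real j / real (Suc m) + real k) / (real (Suc j) / real m + real k))"
  proof (rule prod.cong[OF refl])
    fix j
    have "real j / real (Suc m) + real k = u j / real (Suc m)"
      "real (Suc j) / real m + real k = v j / real m"
      using m by (auto simp: u_def v_def field_simps)
    thus "(real m / real (Suc m)) * (u j / v j) = (real j / real (Suc m) + real k) / (real (Suc j) / real m + real k)"
      by simp
  qed
  finally show ?case unfolding Suc by (simp add: pochhammer_Suc prod.distrib prod_dividef mult_ac)
qed

lemma moment_model_fuss_catalan:
  assumes m: "m \<ge> 1"
  obtains G K where "K > 0" "moment_model (fuss_catalan m) K G"
proof -
  obtain n where n: "m = Suc n" using m by (cases m) auto
  have "\<exists>\<mu>. moment_model (\<lambda>k. \<Prod>j=1..Suc n. pochhammer (real j / real (Suc m)) k / pochhammer (real (Suc j) / real m) k) 1 \<mu>"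
  proof (rule moment_model_prod)
    fix j assume j: "j \<in> {1..Suc n}"
    define a where "a = real j / real (Suc m)"
    define b where "b = real (Suc j) / real m - a"
    have "a > 0" using j by (simp add: a_def)
    moreover have "b > 0" using m by (auto simp: b_def a_def field_simps intro!: divide_pos_pos add_pos_nonneg)
    ultimately have "moment_model (\<lambda>k. pochhammer a k / pochhammer (a + b) k) 1 (beta_measure a b)"
      by (rule moment_model_beta)
    thus "\<exists>\<mu>. moment_model (\<lambda>k. pochhammer (real j / real (Suc m)) k / pochhammer (real (Suc j) / real m) k) 1 \<mu>"
      by (auto simp: a_def b_def)
  qed
  then obtain \<mu> where \<mu>: "moment_model (\<lambda>k. \<Prod>j=1..m. pochhammer (real j / real (Suc m)) k / pochhammer (real (Suc j) / real m) k) 1 \<mu>"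
    unfolding n by blast
  \<comment> \<open>This is the exponential growth rate of the Fuss-Catalan numbers; the beta
    variables lie in [0, 1], so it bounds the support.\<close>
  have K: "real (Suc m) ^ Suc m / real m ^ m > 0" using m by simp
  show ?thesis
    by (rule that[OF _ moment_model_scale[OF \<mu> K, folded fuss_catalan_beta[OF m]]]) (use K in simp)
qed

lemma fuss_catalan_measure_eq:
  assumes "moment_model (fuss_catalan m) K G" "K > 0"
  shows "fuss_catalan_measure m = G"
  unfolding fuss_catalan_measure_def
proof (rule the_equality)
  show "real_distribution G \<and> has_fuss_catalan_moments m G"
    using assms(1) by (simp add: moment_model_def has_fuss_catalan_moments_def)
  fix \<mu> assume \<mu>: "real_distribution \<mu> \<and> has_fuss_catalan_moments m \<mu>"
  show "\<mu> = G"
    using assms \<mu> moment_model_atomless[OF assms(1)]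
    by (intro bounded_moments_unique[of G K "fuss_catalan m"])
       (auto simp: moment_model_def has_fuss_catalan_moments_def)
qed

section \<open>Truncated entries\<close>

lemma walk_weight_prod:
  assumes "length w = length es" "finite S" "set es \<subseteq> S"
  shows "walk_weight Y w es =
    (\<Prod>e\<in>S. Y e ^ count_list (zip w es) (True, e) * cnj (Y e) ^ count_list (zip w es) (False, e))"
  using assms(1,3)
proof (induction w es rule: list_induct2)
  case Nil
  show ?case by (simp add: walk_weight_def)
next
  case (Cons a w e0 es)
  let ?f = "if a then Y e0 else cnj (Y e0)"
  let ?c = "\<lambda>b e. count_list (zip w es) (b, e)"
  have "walk_weight Y (a # w) (e0 # es) = ?f * walk_weight Y w es" by (simp add: walk_weight_def)
  also have "\<dots> = (\<Prod>e\<in>S. if e = e0 then ?f else 1) * (\<Prod>e\<in>S. Y e ^ ?c True e * cnj (Y e) ^ ?c False e)"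
    using Cons assms(2) by simp
  also have "\<dots> = (\<Prod>e\<in>S. Y e ^ count_list (zip (a # w) (e0 # es)) (True, e)
        * cnj (Y e) ^ count_list (zip (a # w) (e0 # es)) (False, e))"
    unfolding prod.distrib[symmetric] by (intro prod.cong) (auto simp: mult_ac)
  finally show ?case .
qed

lemma walk_weight_measurable:
  assumes "\<And>e. e \<in> set es \<Longrightarrow> (\<lambda>\<omega>. Y \<omega> e) \<in> borel_measurable M" "length w = length es"
  shows "(\<lambda>\<omega>. walk_weight (Y \<omega>) w es) \<in> borel_measurable M"
  unfolding walk_weight_prod[OF assms(2) finite_set order_refl]
  using assms(1) by (intro borel_measurable_prod borel_measurable_times borel_measurable_power
      borel_measurable_continuous_on[OF _ assms(1)] continuous_intros)

section \<open>Measurability of traces and of eigenvalue distribution functions\<close>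

lemma set_walk_edges:
  assumes "length ks = length w"
  shows "set (walk_edges i w ks) \<subseteq> insert i (set ks) \<times> insert i (set ks)"
  using assms by (induction i w ks rule: walk_edges.induct) auto

lemma mat_trace_word_measurable:
  fixes X :: "'a \<Rightarrow> complex mat"
  assumes X: "\<And>\<omega>. X \<omega> \<in> carrier_mat n n"
    and meas: "\<And>i j. i < n \<Longrightarrow> j < n \<Longrightarrow> (\<lambda>\<omega>. X \<omega> $$ (i, j)) \<in> borel_measurable M"
  shows "(\<lambda>\<omega>. mat_trace (word_mat (X \<omega>) w)) \<in> borel_measurable M"
  unfolding mat_trace_word_mat[OF X]
proof (intro borel_measurable_sum walk_weight_measurable)
  fix i ks e
  assume "i \<in> {..<n}" "ks \<in> {ks. length ks = length w \<and> set ks \<subseteq> {..<n} \<and> last (i # ks) = i}"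
  hence *: "i < n" "set ks \<subseteq> {..<n}" "length ks = length w" by auto
  thus "length w = length (walk_edges i w ks)" by (simp add: length_walk_edges)
  assume "e \<in> set (walk_edges i w ks)"
  hence "e \<in> {..<n} \<times> {..<n}" using set_walk_edges[OF *(3), of i] * by auto
  thus "(\<lambda>\<omega>. X \<omega> $$ e) \<in> borel_measurable M" using meas by auto
qed

text \<open>No measurable choice of eigenvalues is made: spectral means of polynomials are
  combinations of traces, hence measurable, and the indicator is a pointwise limit of
  polynomials.\<close>

lemma power_product_cdf_measurable:
  fixes X :: "'a \<Rightarrow> complex mat"
  assumes X: "\<And>\<omega>. X \<omega> \<in> carrier_mat n n"
    and meas: "\<And>i j. i < n \<Longrightarrow> j < n \<Longrightarrow> (\<lambda>\<omega>. X \<omega> $$ (i, j)) \<in> borel_measurable M"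
  shows "(\<lambda>\<omega>. power_product_cdf m (X \<omega>) t) \<in> borel_measurable M"
proof -
  define W where "W \<omega> = X \<omega> ^\<^sub>m m * mat_adjoint (X \<omega>) ^\<^sub>m m" for \<omega>
  have W: "W \<omega> \<in> carrier_mat n n" for \<omega>
    unfolding W_def using X[of \<omega>] by (auto intro!: mult_carrier_mat[of _ n n])
  have "(\<lambda>\<omega>. spectral_mean (W \<omega>) (poly p)) \<in> borel_measurable M" for p
  proof -
    have "(\<lambda>\<omega>. mat_trace (W \<omega> ^\<^sub>m k)) \<in> borel_measurable M" for k
      unfolding W_def power_product_word_mat[OF X] by (rule mat_trace_word_measurable[OF X meas])
    hence tr: "(\<lambda>\<omega>. Re (mat_trace (W \<omega> ^\<^sub>m k))) \<in> borel_measurable M" for k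
      by (simp add: borel_measurable_complex_iff)
    have herm: "mat_adjoint (W \<omega>) = W \<omega>" for \<omega>
      unfolding W_def by (rule power_product_hermitian[OF X])
    show ?thesis
      unfolding spectral_mean_poly[OF W herm]
      by (intro borel_measurable_sum borel_measurable_times borel_measurable_divide borel_measurable_const tr)
  qed
  moreover obtain P where "\<And>x. (\<lambda>n. poly (P n) x) \<longlonglongrightarrow> of_bool (x \<le> t)"
    using poly_tendsto_of_bool_le by blast
  hence "(\<lambda>k. spectral_mean (W \<omega>) (poly (P k))) \<longlonglongrightarrow> spectral_mean (W \<omega>) (\<lambda>x. of_bool (x \<le> t))" for \<omega>
    by (rule spectral_mean_tendsto)
  ultimately have "(\<lambda>\<omega>. spectral_mean (W \<omega>) (\<lambda>x. of_bool (x \<le> t))) \<in> borel_measurable M"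
    by (rule borel_measurable_LIMSEQ_real[rotated])
  thus ?thesis by (simp add: power_product_cdf_def eigenvalue_cdf_spectral_mean W_def)
qed

lemma norm_integral_le_integral:
  fixes f :: "'a \<Rightarrow> 'b::{banach, second_countable_topology}"
  assumes "integrable M f" "integrable M g" "\<And>x. norm (f x) \<le> g x"
  shows "norm (\<integral>x. f x \<partial>M) \<le> (\<integral>x. g x \<partial>M)"
proof -
  have "norm (\<integral>x. f x \<partial>M) \<le> (\<integral>x. norm (f x) \<partial>M)" by (rule integral_norm_bound)
  also have "\<dots> \<le> (\<integral>x. g x \<partial>M)" using assms by (intro integral_mono integrable_norm) auto
  finally show ?thesis .
qed

lemma borel_measurable_cnj [measurable]: "cnj \<in> borel_measurable borel"
  by (intro borel_measurable_continuous_onI continuous_intros)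

section \<open>Moments of the truncated and scaled entries\<close>

locale iid_array = prob_space M for M :: "'a measure" +
  fixes x :: "'a \<Rightarrow> complex" and xs :: "nat \<Rightarrow> nat \<Rightarrow> 'a \<Rightarrow> complex"
  assumes x_meas [measurable]: "x \<in> borel_measurable M"
    and x_int: "integrable M x" and x_mean: "(\<integral>\<omega>. x \<omega> \<partial>M) = 0"
    and x_int2: "integrable M (\<lambda>\<omega>. (cmod (x \<omega>))\<^sup>2)" and x_var: "(\<integral>\<omega>. (cmod (x \<omega>))\<^sup>2 \<partial>M) = 1"
    and x_int4: "integrable M (\<lambda>\<omega>. (cmod (x \<omega>)) ^ 4)"
    and xs_indep: "indep_vars (\<lambda>_. borel) (\<lambda>(i, j). xs i j) ({1..} \<times> {1..})"
    and xs_distr: "\<And>i j. i \<ge> 1 \<Longrightarrow> j \<ge> 1 \<Longrightarrow> distr M borel (xs i j) = distr M borel x"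
begin

lemma xs_meas: "i \<ge> 1 \<Longrightarrow> j \<ge> 1 \<Longrightarrow> xs i j \<in> borel_measurable M"
  using xs_indep unfolding indep_vars_def by auto

lemma integral_xs:
  fixes g :: "complex \<Rightarrow> 'b::{banach, second_countable_topology}"
  assumes "i \<ge> 1" "j \<ge> 1" "g \<in> borel_measurable borel"
  shows "(\<integral>\<omega>. g (xs i j \<omega>) \<partial>M) = (\<integral>\<omega>. g (x \<omega>) \<partial>M)"
  using integral_distr[OF xs_meas[OF assms(1,2)] assms(3)] integral_distr[OF x_meas assms(3)]
    xs_distr[OF assms(1,2)] by simp

definition trunc :: "nat \<Rightarrow> complex \<Rightarrow> complex" where
  "trunc N z = (if cmod z \<le> sqrt (real N) then z else 0)"

definition entry :: "nat \<Rightarrow> complex \<Rightarrow> complex" where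
  "entry N z = complex_of_real (real N powr (-1/2)) * trunc N z"

lemma trunc_meas [measurable]: "trunc N \<in> borel_measurable borel"
  unfolding trunc_def[abs_def] by measurable

lemma entry_meas [measurable]: "entry N \<in> borel_measurable borel"
  unfolding entry_def[abs_def] by measurable

lemma entry_altdef: "entry N z = trunc N z / complex_of_real (sqrt (real N))"
  using powr_minus_divide[of "real N" "1 / 2"]
  by (simp add: entry_def powr_half_sqrt of_real_divide)

lemma cmod_entry: "cmod (entry N z) = cmod (trunc N z) / sqrt (real N)"
  by (simp add: entry_altdef norm_divide)

lemma cmod_trunc: "cmod (trunc N z) \<le> cmod z" "cmod (trunc N z) \<le> sqrt (real N)"
  by (auto simp: trunc_def)

lemma integrable_trunc: "integrable M (\<lambda>\<omega>. trunc N (x \<omega>))"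
  using cmod_trunc(2) by (intro integrable_const_bound[of _ "sqrt (real N)"]) auto

lemma cmod_entry_le_1: "cmod (entry N z) \<le> 1"
  using cmod_trunc(2)[of N z] unfolding cmod_entry by (intro divide_le_eq_1[THEN iffD2]) auto

definition mixed_moment :: "nat \<Rightarrow> nat \<Rightarrow> nat \<Rightarrow> complex" where
  "mixed_moment N a b = (\<integral>\<omega>. entry N (x \<omega>) ^ a * cnj (entry N (x \<omega>)) ^ b \<partial>M)"

text \<open>One constant for all orders: it is at least 1 = E |x|^2, and 1 + r^4 dominates r^3 as
  well as, for r > sqrt N with N > 0, the product r * N.\<close>

definition moment_const :: real where
  "moment_const = 1 + (\<integral>\<omega>. (cmod (x \<omega>)) ^ 4 \<partial>M)"

lemma moment_const_ge_1: "moment_const \<ge> 1"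
  unfolding moment_const_def by (simp add: integral_nonneg)

lemma integrable_entry_power [simp]:
  assumes "f \<in> borel_measurable M"
  shows "integrable M (\<lambda>\<omega>. entry N (f \<omega>) ^ a * cnj (entry N (f \<omega>)) ^ b)"
proof (rule integrable_const_bound)
  show "AE \<omega> in M. norm (entry N (f \<omega>) ^ a * cnj (entry N (f \<omega>)) ^ b) \<le> 1"
    by (auto simp: norm_mult norm_power intro!: mult_le_one power_le_one cmod_entry_le_1)
  have "(\<lambda>z. entry N z ^ a * cnj (entry N z) ^ b) \<in> borel_measurable borel" by measurable
  from measurable_compose[OF assms this]
  show "(\<lambda>\<omega>. entry N (f \<omega>) ^ a * cnj (entry N (f \<omega>)) ^ b) \<in> borel_measurable M" .
qed

lemma mixed_moment_2:
  assumes "a + b = 2" "N > 0"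
  shows "cmod (mixed_moment N a b) \<le> 1 / real N"
proof -
  have "cmod (mixed_moment N a b) \<le> (\<integral>\<omega>. (cmod (x \<omega>))\<^sup>2 / real N \<partial>M)"
    unfolding mixed_moment_def
  proof (rule norm_integral_le_integral)
    fix \<omega>
    have "norm (entry N (x \<omega>) ^ a * cnj (entry N (x \<omega>)) ^ b) = cmod (entry N (x \<omega>)) ^ 2"
      using assms(1) by (simp add: norm_mult norm_power power_add[symmetric])
    also have "\<dots> = (cmod (trunc N (x \<omega>)))\<^sup>2 / real N"
      by (simp add: cmod_entry power_divide)
    also have "\<dots> \<le> (cmod (x \<omega>))\<^sup>2 / real N"
      using cmod_trunc(1)[of N "x \<omega>"] by (intro divide_right_mono power_mono) auto
    finally show "norm (entry N (x \<omega>) ^ a * cnj (entry N (x \<omega>)) ^ b) \<le> (cmod (x \<omega>))\<^sup>2 / real N" .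
  qed (use x_int2 in auto)
  thus ?thesis using x_var by simp
qed

text \<open>The scaled entry is at most 1 in modulus, so higher powers are bounded by the cube,
  whose mean the fourth moment of x controls.\<close>

lemma mixed_moment_ge_3:
  assumes "a + b \<ge> 3" "N > 0"
  shows "cmod (mixed_moment N a b) \<le> moment_const / (real N * sqrt (real N))"
proof -
  have "cmod (mixed_moment N a b) \<le> (\<integral>\<omega>. (1 + cmod (x \<omega>) ^ 4) / (real N * sqrt (real N)) \<partial>M)"
    unfolding mixed_moment_def
  proof (rule norm_integral_le_integral)
    fix \<omega>
    have "norm (entry N (x \<omega>) ^ a * cnj (entry N (x \<omega>)) ^ b) = cmod (entry N (x \<omega>)) ^ (a + b)"
      by (simp add: norm_mult norm_power power_add)
    also have "\<dots> \<le> cmod (entry N (x \<omega>)) ^ 3"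
      using assms(1) cmod_entry_le_1 by (intro power_decreasing) auto
    also have "\<dots> = (cmod (trunc N (x \<omega>))) ^ 3 / (real N * sqrt (real N))"
      by (simp add: cmod_entry power_divide power3_eq_cube)
    also have "\<dots> \<le> (1 + cmod (x \<omega>) ^ 4) / (real N * sqrt (real N))"
    proof (rule divide_right_mono)
      have "cmod (trunc N (x \<omega>)) ^ 3 \<le> cmod (x \<omega>) ^ 3"
        using cmod_trunc(1) by (intro power_mono) auto
      also have "\<dots> \<le> 1 + cmod (x \<omega>) ^ 4"
      proof (cases "cmod (x \<omega>) \<le> 1")
        case True
        hence "cmod (x \<omega>) ^ 3 \<le> 1" by (intro power_le_one) auto
        thus ?thesis by (smt (verit) zero_le_power norm_ge_zero)
      next
        case False
        hence "cmod (x \<omega>) ^ 3 \<le> cmod (x \<omega>) ^ 4" by (intro power_increasing) auto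
        thus ?thesis by simp
      qed
      finally show "cmod (trunc N (x \<omega>)) ^ 3 \<le> 1 + cmod (x \<omega>) ^ 4" .
    qed auto
    finally show "norm (entry N (x \<omega>) ^ a * cnj (entry N (x \<omega>)) ^ b)
        \<le> (1 + cmod (x \<omega>) ^ 4) / (real N * sqrt (real N))" .
  qed (use x_int4 in auto)
  also have "\<dots> = moment_const / (real N * sqrt (real N))"
    using x_int4 by (simp add: moment_const_def prob_space)
  finally show ?thesis .
qed

text \<open>As x has mean 0, the truncated mean is minus the mean of the removed part. There |x| >
  sqrt N, hence |x| is at most |x|^4 / N.\<close>

lemma mixed_moment_1:
  assumes "a + b = 1" "N > 0"
  shows "cmod (mixed_moment N a b) \<le> moment_const / (real N * sqrt (real N))"
proof -
  define m where "m = (\<integral>\<omega>. entry N (x \<omega>) \<partial>M)"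
  have "mixed_moment N a b = m \<or> mixed_moment N a b = cnj m"
  proof -
    have "(a = 1 \<and> b = 0) \<or> (a = 0 \<and> b = 1)" using assms(1) by auto
    thus ?thesis by (auto simp: mixed_moment_def m_def)
  qed
  hence "cmod (mixed_moment N a b) = cmod m" by auto
  also have "m = (\<integral>\<omega>. trunc N (x \<omega>) \<partial>M) / complex_of_real (sqrt (real N))"
    by (simp add: m_def entry_altdef)
  also have "(\<integral>\<omega>. trunc N (x \<omega>) \<partial>M) = - (\<integral>\<omega>. x \<omega> - trunc N (x \<omega>) \<partial>M)"
  proof -
    show ?thesis using x_int x_mean integrable_trunc by simp
  qed
  also have "cmod (- (\<integral>\<omega>. x \<omega> - trunc N (x \<omega>) \<partial>M) / complex_of_real (sqrt (real N)))
      = cmod (\<integral>\<omega>. x \<omega> - trunc N (x \<omega>) \<partial>M) / sqrt (real N)"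
    by (simp add: norm_divide)
  also have "\<dots> \<le> (moment_const / real N) / sqrt (real N)"
  proof (rule divide_right_mono)
    have "cmod (\<integral>\<omega>. x \<omega> - trunc N (x \<omega>) \<partial>M) \<le> (\<integral>\<omega>. (1 + cmod (x \<omega>) ^ 4) / real N \<partial>M)"
    proof (rule norm_integral_le_integral)
      show "integrable M (\<lambda>\<omega>. x \<omega> - trunc N (x \<omega>))"
        using x_int integrable_trunc by simp
      fix \<omega>
      show "cmod (x \<omega> - trunc N (x \<omega>)) \<le> (1 + cmod (x \<omega>) ^ 4) / real N"
      proof (cases "cmod (x \<omega>) \<le> sqrt (real N)")
        case True
        thus ?thesis by (simp add: trunc_def)
      next
        case False
        define r where "r = cmod (x \<omega>)"
        have r: "r > sqrt (real N)" using False by (simp add: r_def)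
        have "sqrt (real N) \<ge> 1" using assms(2) by simp
        hence r1: "r \<ge> 1" using r by linarith
        have "real N \<le> r\<^sup>2" using r by (metis less_imp_le real_sqrt_le_iff real_sqrt_le_mono sqrt_le_D)
        hence "r * real N \<le> r * r\<^sup>2" using r1 by (intro mult_left_mono) auto
        also have "\<dots> \<le> r ^ 4" using r1 by (simp add: power_eq_if)
        finally have "r * real N \<le> 1 + r ^ 4" by simp
        hence "r \<le> (1 + r ^ 4) / real N" using assms(2) by (simp add: field_simps)
        thus ?thesis using False by (simp add: trunc_def r_def)
      qed
    qed (use x_int4 in auto)
    also have "\<dots> = moment_const / real N"
      using x_int4 by (simp add: moment_const_def prob_space)
    finally show "cmod (\<integral>\<omega>. x \<omega> - trunc N (x \<omega>) \<partial>M) \<le> moment_const / real N" .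
  qed simp
  finally show ?thesis by simp
qed

text \<open>Each distinct entry of a walk costs a factor of order 1/N, and it gains a further 1 /
  sqrt N unless it is used exactly twice.\<close>

lemma mixed_moment_bound:
  assumes "a + b \<noteq> 0" "N > 0"
  shows "cmod (mixed_moment N a b) \<le> (moment_const / real N) * (if a + b = 2 then 1 else 1 / sqrt (real N))"
proof -
  consider "a + b = 1" | "a + b = 2" | "a + b \<ge> 3" using assms(1) by linarith
  thus ?thesis
  proof cases
    case 2
    have "1 / real N \<le> moment_const / real N" using moment_const_ge_1 by (intro divide_right_mono) auto
    thus ?thesis using mixed_moment_2[OF 2 assms(2)] 2 by simp
  qed (use mixed_moment_1[of a b N] mixed_moment_ge_3[of a b N] assms in auto)
qed

lemma mixed_moment_1_1: "(\<lambda>N. complex_of_real (real N) * mixed_moment N 1 1) \<longlonglongrightarrow> 1"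
proof -
  have "(\<lambda>N. \<integral>\<omega>. (cmod (trunc N (x \<omega>)))\<^sup>2 \<partial>M) \<longlonglongrightarrow> (\<integral>\<omega>. (cmod (x \<omega>))\<^sup>2 \<partial>M)"
  proof (rule integral_dominated_convergence)
    show "AE \<omega> in M. (\<lambda>N. (cmod (trunc N (x \<omega>)))\<^sup>2) \<longlonglongrightarrow> (cmod (x \<omega>))\<^sup>2"
    proof (rule AE_I2, rule tendsto_eventually)
      fix \<omega>
      have "eventually (\<lambda>N. cmod (x \<omega>) \<le> sqrt (real N)) sequentially" by real_asymp
      thus "eventually (\<lambda>N. (cmod (trunc N (x \<omega>)))\<^sup>2 = (cmod (x \<omega>))\<^sup>2) sequentially"
        by eventually_elim (simp add: trunc_def)
    qed
    show "AE \<omega> in M. norm ((cmod (trunc N (x \<omega>)))\<^sup>2) \<le> (cmod (x \<omega>))\<^sup>2" for N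
      using cmod_trunc(1) by (auto intro!: power_mono)
  qed (use x_int2 in auto)
  hence "(\<lambda>N. complex_of_real (\<integral>\<omega>. (cmod (trunc N (x \<omega>)))\<^sup>2 \<partial>M)) \<longlonglongrightarrow> 1"
    using x_var tendsto_of_real by fastforce
  moreover have "eventually (\<lambda>N. complex_of_real (\<integral>\<omega>. (cmod (trunc N (x \<omega>)))\<^sup>2 \<partial>M)
      = complex_of_real (real N) * mixed_moment N 1 1) sequentially"
    using eventually_gt_at_top[of 0]
  proof eventually_elim
    case (elim N)
    have "mixed_moment N 1 1 = (\<integral>\<omega>. complex_of_real ((cmod (trunc N (x \<omega>)))\<^sup>2 / real N) \<partial>M)"
      unfolding mixed_moment_def power_one_right complex_norm_square[symmetric]
      by (simp only: cmod_entry power_divide) (simp add: elim)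
    also have "\<dots> = complex_of_real ((\<integral>\<omega>. (cmod (trunc N (x \<omega>)))\<^sup>2 \<partial>M) / real N)"
      by (simp only: integral_complex_of_real integral_divide_zero)
    finally show ?case using elim by simp
  qed
  ultimately show ?thesis by (rule Lim_transform_eventually)
qed

end

section \<open>Convergence of moments and of distribution functions\<close>

lemma scaled_matrix_carrier [simp]: "scaled_matrix y N \<in> carrier_mat N N"
  by (simp add: scaled_matrix_def)

lemma scaled_matrix_index:
  "i < N \<Longrightarrow> j < N \<Longrightarrow>
     scaled_matrix y N $$ (i, j) = complex_of_real (real N powr (-1/2)) * y (Suc i) (Suc j)"
  by (simp add: scaled_matrix_def)

lemma scaled_matrix_cong:
  assumes "\<And>i j. i \<in> {1..N} \<Longrightarrow> j \<in> {1..N} \<Longrightarrow> y i j = z i j"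
  shows "scaled_matrix y N = scaled_matrix z N"
  using assms by (auto simp: scaled_matrix_def intro!: eq_matI)

lemma power_product_cdf_bounds:
  assumes "X \<in> carrier_mat n n"
  shows "0 \<le> power_product_cdf m X t" "power_product_cdf m X t \<le> 1"
proof -
  have "X ^\<^sub>m m * mat_adjoint X ^\<^sub>m m \<in> carrier_mat n n"
    using assms by (auto intro!: mult_carrier_mat[of _ n n])
  from spectral_mean_bound[OF this, of "\<lambda>x. of_bool (x \<le> t)"]
  show "0 \<le> power_product_cdf m X t" "power_product_cdf m X t \<le> 1"
    by (auto simp: power_product_cdf_def eigenvalue_cdf_spectral_mean)
qed

definition closed_walks :: "nat \<Rightarrow> nat \<Rightarrow> nat \<Rightarrow> nat list set" where
  "closed_walks N l i = {ks. length ks = l \<and> set ks \<subseteq> {..<N} \<and> last (i # ks) = i}"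

lemma finite_closed_walks [simp]: "finite (closed_walks N l i)"
  by (rule finite_subset[OF _ finite_lists_length_eq[of "{..<N}" l]]) (auto simp: closed_walks_def)

lemma sum_walks_card_vertices:
  assumes "N > 0"
  shows "(\<Sum>i<N. \<Sum>ks\<in>closed_walks N l i. (1 / real N) ^ card (insert i (set ks))) \<le> fact (Suc l)"
proof -
  have "(\<Sum>i<N. \<Sum>ks\<in>closed_walks N l i. (1 / real N) ^ card (insert i (set ks)))
      \<le> (\<Sum>i<N. \<Sum>ks | length ks = l \<and> set ks \<subseteq> {..<N} \<and> True. (1 / real N) ^ card (set (i # ks)))"
  proof (intro sum_mono)
    fix i
    have "finite {ks. length ks = l \<and> set ks \<subseteq> {..<N} \<and> True}"
      using finite_lists_length_eq[of "{..<N}" l] by (simp add: conj_commute)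
    thus "(\<Sum>ks\<in>closed_walks N l i. (1 / real N) ^ card (insert i (set ks)))
      \<le> (\<Sum>ks | length ks = l \<and> set ks \<subseteq> {..<N} \<and> True. (1 / real N) ^ card (set (i # ks)))"
      unfolding list.set by (rule sum_mono2) (auto simp: closed_walks_def)
  qed
  also have "\<dots> = (\<Sum>ks | length ks = Suc l \<and> set ks \<subseteq> {..<N} \<and> True. (1 / real N) ^ card (set ks))"
    by (rule sum_Cons_lists[symmetric]) simp
  also have "\<dots> = (\<Sum>ks | set ks \<subseteq> {..<N} \<and> length ks = Suc l. (1 / real (card {..<N})) ^ card (set ks))"
    by (rule sum.cong) auto
  also have "\<dots> \<le> fact (Suc l)"
    by (rule sum_lists_card_set_le) (use assms in auto)
  finally show ?thesis .
qed

lemma one_div_sqrt: "0 < r \<Longrightarrow> 1 / sqrt r = sqrt r * (1 / r)"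
  by (simp add: field_simps)

context iid_array
begin

section \<open>Expected weights of walks and limits of expected traces\<close>

definition array_entry :: "nat \<Rightarrow> 'a \<Rightarrow> nat \<times> nat \<Rightarrow> complex" where
  "array_entry N \<omega> e = entry N (xs (Suc (fst e)) (Suc (snd e)) \<omega>)"

lemma array_entry_meas: "(\<lambda>\<omega>. array_entry N \<omega> e) \<in> borel_measurable M"
  unfolding array_entry_def by (rule measurable_compose[OF xs_meas entry_meas]) auto

lemma cmod_walk_weight_le_1:
  assumes "\<And>e. cmod (Y e) \<le> 1" "length w = length es"
  shows "cmod (walk_weight Y w es) \<le> 1"
  using assms(2)
proof (induction w es rule: list_induct2)
  case (Cons a w e es)
  thus ?case using assms(1)[of e] by (auto simp: walk_weight_def norm_mult intro!: mult_le_one)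
qed (simp add: walk_weight_def)

lemma integrable_walk_weight:
  assumes "length w = length es"
  shows "integrable M (\<lambda>\<omega>. walk_weight (array_entry N \<omega>) w es)"
  by (rule integrable_const_bound[of _ 1])
     (auto intro!: cmod_walk_weight_le_1 walk_weight_measurable array_entry_meas assms
       simp: array_entry_def cmod_entry_le_1)

lemma expectation_walk_weight:
  assumes "length w = length es"
  shows "(\<integral>\<omega>. walk_weight (array_entry N \<omega>) w es \<partial>M) =
    (\<Prod>e\<in>set es. mixed_moment N (count_list (zip w es) (True, e)) (count_list (zip w es) (False, e)))"
proof -
  \<comment> \<open>Matrix positions start at 0 and the array at 1: \<open>s\<close> passes from the
    former to the latter, and \<open>r\<close> goes back.\<close>
  define s where "s = (\<lambda>e :: nat \<times> nat. (Suc (fst e), Suc (snd e)))"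
  define r where "r = (\<lambda>e :: nat \<times> nat. (fst e - 1, snd e - 1))"
  define c where "c b e = count_list (zip w es) (b, e)" for b e
  define g where "g e z = entry N z ^ c True (r e) * cnj (entry N z) ^ c False (r e)" for e z
  define X where "X = (\<lambda>(i, j). xs i j)"
  have rs: "r (s e) = e" for e by (simp add: r_def s_def)
  have array_entry_X: "array_entry N \<omega> e = entry N (X (s e) \<omega>)" for e \<omega>
    by (simp add: array_entry_def X_def s_def)
  have inj: "inj_on s (set es)" by (rule inj_on_inverseI[of _ r]) (rule rs)
  have sub: "s ` set es \<subseteq> {1..} \<times> {1..}" by (auto simp: s_def)
  have g_meas: "g e \<in> borel_measurable borel" for e unfolding g_def by measurable
  have "indep_vars (\<lambda>_. borel) X (s ` set es)"
    using indep_vars_subset[OF xs_indep sub] by (simp add: X_def)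
  hence indep: "indep_vars (\<lambda>_. borel) (\<lambda>e \<omega>. g e (X e \<omega>)) (s ` set es)"
    by (rule indep_vars_compose2) (rule g_meas)
  have X_meas: "X e \<in> borel_measurable M" if "e \<in> s ` set es" for e
    using that sub xs_meas by (auto simp: X_def)
  have int: "integrable M (\<lambda>\<omega>. g e (X e \<omega>))" if "e \<in> s ` set es" for e
    unfolding g_def by (rule integrable_entry_power[OF X_meas[OF that]])
  have "(\<integral>\<omega>. walk_weight (array_entry N \<omega>) w es \<partial>M) = (\<integral>\<omega>. (\<Prod>e\<in>s ` set es. g e (X e \<omega>)) \<partial>M)"
    unfolding walk_weight_prod[OF assms finite_set order_refl] prod.reindex[OF inj]
    by (simp add: g_def rs array_entry_X c_def)
  also have "\<dots> = (\<Prod>e\<in>s ` set es. \<integral>\<omega>. g e (X e \<omega>) \<partial>M)"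
    by (rule indep_vars_lebesgue_integral[OF _ indep int]) auto
  also have "\<dots> = (\<Prod>e\<in>set es. \<integral>\<omega>. g (s e) (x \<omega>) \<partial>M)"
    unfolding prod.reindex[OF inj] comp_def
  proof (rule prod.cong[OF refl])
    fix e
    show "(\<integral>\<omega>. g (s e) (X (s e) \<omega>) \<partial>M) = (\<integral>\<omega>. g (s e) (x \<omega>) \<partial>M)"
      using integral_xs[OF _ _ g_meas, of "Suc (fst e)" "Suc (snd e)"] by (simp add: X_def s_def)
  qed
  also have "\<dots> = (\<Prod>e\<in>set es. mixed_moment N (c True e) (c False e))"
    by (simp add: g_def rs mixed_moment_def)
  finally show ?thesis by (simp add: c_def)
qed

definition walk_mean :: "nat \<Rightarrow> bool list \<Rightarrow> nat \<Rightarrow> nat list \<Rightarrow> complex" where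
  "walk_mean N w i ks = (\<integral>\<omega>. walk_weight (array_entry N \<omega>) w (walk_edges i w ks) \<partial>M)"

lemma walk_mean_tree_walk:
  assumes "tree_walk [] {i} i w ks" "length ks = length w" "length w = 2 * q"
  shows "walk_mean N w i ks = mixed_moment N 1 1 ^ q"
proof -
  have "walk_mean N w i ks = (\<Prod>e\<in>set (walk_edges i w ks). mixed_moment N 1 1)"
    unfolding walk_mean_def expectation_walk_weight[OF length_walk_edges[OF assms(2), symmetric]]
    by (rule prod.cong) (use tree_walk_letter_counts[OF assms(1,2)] in auto)
  thus ?thesis using tree_walk_card_edges[OF assms(1,2)] assms(3) by simp
qed

text \<open>Either all edges are used exactly twice, and then there are at most as many vertices as
  edges; or some edge is not, which gains 1 / sqrt N and compensates for at most one surplus vertex.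
  The factor sqrt N is slack in the first case and attained by the estimate in the second.\<close>

lemma walk_mean_not_tree_walk:
  assumes "\<not> tree_walk [] {i} i w ks" "length ks = length w" "N > 0"
  shows "cmod (walk_mean N w i ks)
    \<le> moment_const ^ length w * sqrt (real N) * (1 / real N) ^ card (insert i (set ks))"
proof -
  define es where "es = walk_edges i w ks"
  define v where "v = card (insert i (set ks))"
  define E where "E = card (set es)"
  have len: "length es = length w" unfolding es_def by (rule length_walk_edges[OF assms(2)])
  have N: "real N \<ge> 1" "sqrt (real N) \<ge> 1" using assms(3) by auto
  let ?f = "\<lambda>e. if count_list es e = 2 then 1 else 1 / sqrt (real N)"
  have f: "0 \<le> ?f e" "?f e \<le> 1" for e using N by auto
  have "cmod (walk_mean N w i ks)
      = (\<Prod>e\<in>set es. cmod (mixed_moment N (count_list (zip w es) (True, e)) (count_list (zip w es) (False, e))))"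
    unfolding walk_mean_def es_def[symmetric] expectation_walk_weight[OF len[symmetric]] by (rule prod_norm[symmetric])
  also have "\<dots> \<le> (\<Prod>e\<in>set es. (moment_const / real N) * ?f e)"
  proof (rule prod_mono)
    fix e assume e: "e \<in> set es"
    have "count_list (zip w es) (True, e) + count_list (zip w es) (False, e) = count_list es e"
      by (rule count_list_zip_bool[OF len[symmetric]])
    moreover have "count_list es e \<noteq> 0" using e by (simp add: count_list_0_iff)
    ultimately show "0 \<le> cmod (mixed_moment N (count_list (zip w es) (True, e)) (count_list (zip w es) (False, e))) \<and>
       cmod (mixed_moment N (count_list (zip w es) (True, e)) (count_list (zip w es) (False, e)))
         \<le> (moment_const / real N) * ?f e"
      using mixed_moment_bound[of "count_list (zip w es) (True, e)" "count_list (zip w es) (False, e)" N] assms(3)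
      by simp
  qed
  also have "\<dots> = moment_const ^ E * ((1 / real N) ^ E * (\<Prod>e\<in>set es. ?f e))"
    by (simp only: prod.distrib prod_constant E_def) (simp add: power_divide)
  also have "\<dots> \<le> moment_const ^ length w * (sqrt (real N) * (1 / real N) ^ v)"
  proof (rule mult_mono)
    have "E \<le> length w" unfolding E_def using card_length[of es] len by simp
    thus "moment_const ^ E \<le> moment_const ^ length w"
      using moment_const_ge_1 by (rule power_increasing)
    show "(1 / real N) ^ E * (\<Prod>e\<in>set es. ?f e) \<le> sqrt (real N) * (1 / real N) ^ v"
    proof (cases "\<exists>e\<in>set es. count_list es e \<noteq> 2")
      case False
      hence "v \<le> E" using tree_walkI[of ks w i] assms(1,2) unfolding v_def E_def es_def by force
      hence "(1 / real N) ^ E \<le> (1 / real N) ^ v" using N by (intro power_decreasing) auto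
      moreover have "(\<Prod>e\<in>set es. ?f e) = 1" using False by (intro prod.neutral) auto
      moreover have "1 * (1 / real N) ^ v \<le> sqrt (real N) * (1 / real N) ^ v"
        using N by (intro mult_right_mono) auto
      ultimately show ?thesis by simp
    next
      case True
      then obtain e where e: "e \<in> set es" "count_list es e \<noteq> 2" by blast
      have "(\<Prod>e\<in>set es. ?f e) = ?f e * (\<Prod>e\<in>set es - {e}. ?f e)"
        by (rule prod.remove) (use e in auto)
      also have "\<dots> \<le> ?f e * 1"
        by (intro mult_left_mono prod_le_1 f conjI)
      finally have "(\<Prod>e\<in>set es. ?f e) \<le> 1 / sqrt (real N)" using e(2) by simp
      hence "(1 / real N) ^ E * (\<Prod>e\<in>set es. ?f e) \<le> (1 / real N) ^ E * (1 / sqrt (real N))"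
        by (intro mult_left_mono) auto
      also have "\<dots> = sqrt (real N) * (1 / real N) ^ Suc E"
      proof -
        have "1 / sqrt (real N) = sqrt (real N) * (1 / real N)" using N by (intro one_div_sqrt) simp
        thus ?thesis by simp
      qed
      also have "\<dots> \<le> sqrt (real N) * (1 / real N) ^ v"
      proof (intro mult_left_mono power_decreasing)
        show "v \<le> Suc E" unfolding v_def E_def es_def by (rule card_vertices_le_Suc_edges[OF assms(2)])
      qed (use N in auto)
      finally show ?thesis .
    qed
  qed (use moment_const_ge_1 f in \<open>auto intro!: mult_nonneg_nonneg prod_nonneg\<close>)
  finally show ?thesis by (simp add: v_def mult.assoc)
qed

definition trunc_matrix :: "nat \<Rightarrow> 'a \<Rightarrow> complex mat" where
  "trunc_matrix N \<omega> = scaled_matrix (\<lambda>i j. trunc N (xs i j \<omega>)) N"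

lemma trunc_matrix_carrier [simp]: "trunc_matrix N \<omega> \<in> carrier_mat N N"
  by (simp add: trunc_matrix_def)

lemma trunc_matrix_index: "i < N \<Longrightarrow> j < N \<Longrightarrow> trunc_matrix N \<omega> $$ (i, j) = array_entry N \<omega> (i, j)"
  by (simp add: trunc_matrix_def scaled_matrix_index array_entry_def entry_def)

lemma walk_weight_trunc_matrix:
  assumes "i < N" "ks \<in> closed_walks N (length w) i"
  shows "walk_weight (($$) (trunc_matrix N \<omega>)) w (walk_edges i w ks)
    = walk_weight (array_entry N \<omega>) w (walk_edges i w ks)"
proof -
  have ks: "length ks = length w" "set ks \<subseteq> {..<N}" using assms(2) by (auto simp: closed_walks_def)
  have "set (walk_edges i w ks) \<subseteq> {..<N} \<times> {..<N}"
    using set_walk_edges[OF ks(1), of i] ks(2) assms(1) by auto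
  hence "trunc_matrix N \<omega> $$ e = array_entry N \<omega> e" if "e \<in> set (walk_edges i w ks)" for e
    using that trunc_matrix_index by (cases e) auto
  thus ?thesis
    unfolding walk_weight_prod[OF length_walk_edges[OF ks(1), symmetric] finite_set order_refl] by simp
qed

lemma mat_trace_trunc_matrix:
  "mat_trace (word_mat (trunc_matrix N \<omega>) w) =
    (\<Sum>i<N. \<Sum>ks\<in>closed_walks N (length w) i. walk_weight (array_entry N \<omega>) w (walk_edges i w ks))"
  unfolding mat_trace_word_mat[OF trunc_matrix_carrier] closed_walks_def[symmetric]
  by (intro sum.cong refl walk_weight_trunc_matrix) auto

lemma integrable_walk_edges:
  "ks \<in> closed_walks N (length w) i \<Longrightarrow>
     integrable M (\<lambda>\<omega>. walk_weight (array_entry N \<omega>) w (walk_edges i w ks))"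
  by (intro integrable_walk_weight length_walk_edges[symmetric]) (auto simp: closed_walks_def)

lemma integrable_mat_trace: "integrable M (\<lambda>\<omega>. mat_trace (word_mat (trunc_matrix N \<omega>) w))"
  unfolding mat_trace_trunc_matrix by (intro Bochner_Integration.integrable_sum integrable_walk_edges)

lemma expectation_mat_trace:
  "(\<integral>\<omega>. mat_trace (word_mat (trunc_matrix N \<omega>) w) \<partial>M) =
    (\<Sum>i<N. \<Sum>ks\<in>closed_walks N (length w) i. walk_mean N w i ks)"
  unfolding mat_trace_trunc_matrix walk_mean_def
  by (subst Bochner_Integration.integral_sum)
     (auto intro!: Bochner_Integration.integrable_sum integrable_walk_edges sum.cong
        Bochner_Integration.integral_sum)

text \<open>From each start there are \<open>pairings [] w\<close> times (N - 1) ... (N - q) tree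
  walks, each of mean about N^(-q); averaging over the N starts leaves \<open>pairings [] w\<close>.
  The other walks contribute O(sqrt N) before the division by N.\<close>

lemma expectation_mat_trace_limit:
  assumes w: "length w = 2 * q"
  shows "(\<lambda>N. (\<integral>\<omega>. mat_trace (word_mat (trunc_matrix N \<omega>) w) \<partial>M) / complex_of_real (real N))
    \<longlonglongrightarrow> of_nat (pairings [] w)"
proof -
  let ?C = "\<lambda>N i. closed_walks N (length w) i"
  define T where "T N i = {ks. length ks = length w \<and> set ks \<subseteq> {..<N} \<and> tree_walk [] {i} i w ks}"
    for N i :: nat
  define rest where "rest N = (\<Sum>i<N. \<Sum>ks\<in>?C N i - T N i. walk_mean N w i ks)" for N
  \<comment> \<open>Each of the \<open>q\<close> powers of N is paired with one vertex choice and
    one second moment, so that every factor tends to 1 separately.\<close>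
  define main where "main N = of_nat (pairings [] w) * (\<Prod>j<q. complex_of_real (real (N - 1 - j) / real N))
      * (complex_of_real (real N) * mixed_moment N 1 1) ^ q" for N
  have TC: "T N i \<subseteq> ?C N i" for N i
  proof
    fix ks assume ks: "ks \<in> T N i"
    hence "last (i # ks) = i" using tree_walk_last[of "[]" "{i}" i w ks] unfolding T_def by simp
    thus "ks \<in> ?C N i" using ks unfolding T_def closed_walks_def by blast
  qed
  have tree: "(\<Sum>i<N. \<Sum>ks\<in>T N i. walk_mean N w i ks) = complex_of_real (real N) * main N"
    if N: "N > 0" for N
  proof -
    have "(\<Sum>ks\<in>T N i. walk_mean N w i ks) = main N" if "i < N" for i
    proof -
      have "(\<Sum>ks\<in>T N i. walk_mean N w i ks) = of_nat (card (T N i)) * mixed_moment N 1 1 ^ q"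
        using walk_mean_tree_walk[OF _ _ w] by (simp add: T_def)
      also have "card (T N i) = pairings [] w * (\<Prod>j<q. N - 1 - j)"
        using card_tree_walks[of "{..<N}" "{i}" i "[]" w q] that w by (simp add: T_def)
      also have "of_nat (pairings [] w * (\<Prod>j<q. N - 1 - j)) * mixed_moment N 1 1 ^ q = main N"
        using N by (simp add: main_def prod_dividef power_mult_distrib)
      finally show ?thesis .
    qed
    thus ?thesis by simp
  qed
  have rest_bound: "cmod (rest N) / real N \<le> moment_const ^ length w * fact (Suc (length w)) / sqrt (real N)"
    if N: "N > 0" for N
  proof -
    let ?K = "moment_const ^ length w * sqrt (real N)"
    have K: "?K \<ge> 0" using moment_const_ge_1 by simp
    have "cmod (rest N) \<le> (\<Sum>i<N. \<Sum>ks\<in>?C N i - T N i. ?K * (1 / real N) ^ card (insert i (set ks)))"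
      unfolding rest_def
    proof (intro sum_norm_le)
      fix i ks assume "ks \<in> ?C N i - T N i"
      thus "cmod (walk_mean N w i ks) \<le> ?K * (1 / real N) ^ card (insert i (set ks))"
        using N by (intro walk_mean_not_tree_walk) (auto simp: T_def closed_walks_def)
    qed
    also have "\<dots> \<le> (\<Sum>i<N. \<Sum>ks\<in>?C N i. ?K * (1 / real N) ^ card (insert i (set ks)))"
      using K by (intro sum_mono sum_mono2) auto
    also have "\<dots> = ?K * (\<Sum>i<N. \<Sum>ks\<in>?C N i. (1 / real N) ^ card (insert i (set ks)))"
      by (simp add: sum_distrib_left)
    also have "\<dots> \<le> ?K * fact (Suc (length w))"
      using K sum_walks_card_vertices[OF N] by (intro mult_left_mono)
    finally have "cmod (rest N) / real N \<le> ?K * fact (Suc (length w)) / real N"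
      by (rule divide_right_mono) simp
    also have "\<dots> = moment_const ^ length w * fact (Suc (length w)) * (sqrt (real N) / real N)" by simp
    also have "sqrt (real N) / real N = 1 / sqrt (real N)" using one_div_sqrt[of "real N"] N by simp
    finally show ?thesis by simp
  qed
  have split: "(\<integral>\<omega>. mat_trace (word_mat (trunc_matrix N \<omega>) w) \<partial>M) / complex_of_real (real N)
      = main N + rest N / complex_of_real (real N)" if N: "N > 0" for N
  proof -
    have "(\<integral>\<omega>. mat_trace (word_mat (trunc_matrix N \<omega>) w) \<partial>M)
        = (\<Sum>i<N. (\<Sum>ks\<in>?C N i - T N i. walk_mean N w i ks) + (\<Sum>ks\<in>T N i. walk_mean N w i ks))"
      unfolding expectation_mat_trace by (intro sum.cong refl sum.subset_diff TC finite_closed_walks)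
    also have "\<dots> = rest N + complex_of_real (real N) * main N"
      unfolding sum.distrib tree[OF N] rest_def ..
    finally show ?thesis using N by (simp add: field_simps)
  qed
  have "main \<longlonglongrightarrow> of_nat (pairings [] w) * (\<Prod>j<q. complex_of_real 1) * 1 ^ q"
    unfolding main_def
  proof (intro tendsto_mult tendsto_prod tendsto_power tendsto_const mixed_moment_1_1 tendsto_of_real)
    fix j
    have "(\<lambda>N. (real N - 1 - real j) / real N) \<longlonglongrightarrow> 1" by real_asymp
    \<comment> \<open>The index uses truncated subtraction, so it agrees with the real difference
      only from N = j + 1 on.\<close>
    moreover have "eventually (\<lambda>N. (real N - 1 - real j) / real N = real (N - 1 - j) / real N) sequentially"
      using eventually_ge_at_top[of "Suc j"] by eventually_elim (simp add: of_nat_diff)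
    ultimately show "(\<lambda>N. real (N - 1 - j) / real N) \<longlonglongrightarrow> 1" by (rule Lim_transform_eventually)
  qed
  moreover have "(\<lambda>N. rest N / complex_of_real (real N)) \<longlonglongrightarrow> 0"
  proof (rule Lim_null_comparison)
    show "eventually (\<lambda>N. norm (rest N / complex_of_real (real N))
        \<le> moment_const ^ length w * fact (Suc (length w)) / sqrt (real N)) sequentially"
      using eventually_gt_at_top[of 0]
    proof eventually_elim
      case (elim N)
      thus ?case using rest_bound[of N] by (simp add: norm_divide del: fact_Suc)
    qed
    show "(\<lambda>N. moment_const ^ length w * fact (Suc (length w)) / sqrt (real N)) \<longlonglongrightarrow> 0"
    proof -
      have "(\<lambda>N. 1 / sqrt (real N)) \<longlonglongrightarrow> 0" by real_asymp
      from tendsto_mult_right_zero[OF this] show ?thesis by simp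
    qed
  qed
  ultimately have "(\<lambda>N. main N + rest N / complex_of_real (real N)) \<longlonglongrightarrow> of_nat (pairings [] w) + 0"
    by (intro tendsto_add) simp_all
  hence "(\<lambda>N. main N + rest N / complex_of_real (real N)) \<longlonglongrightarrow> of_nat (pairings [] w)"
    unfolding add_0_right .
  moreover have "eventually (\<lambda>N. main N + rest N / complex_of_real (real N)
      = (\<integral>\<omega>. mat_trace (word_mat (trunc_matrix N \<omega>) w) \<partial>M) / complex_of_real (real N)) sequentially"
    using eventually_gt_at_top[of 0] by eventually_elim (rule split[symmetric])
  ultimately show ?thesis by (rule Lim_transform_eventually)
qed

section \<open>Spectral means and distribution functions after truncation\<close>

definition power_product :: "nat \<Rightarrow> nat \<Rightarrow> 'a \<Rightarrow> complex mat" where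
  "power_product m N \<omega> = trunc_matrix N \<omega> ^\<^sub>m m * mat_adjoint (trunc_matrix N \<omega>) ^\<^sub>m m"

lemma power_product_carrier: "power_product m N \<omega> \<in> carrier_mat N N"
  unfolding power_product_def by (auto intro!: mult_carrier_mat[of _ N N] pow_carrier_mat mat_adjoint_carrier)

lemma power_product_adjoint: "mat_adjoint (power_product m N \<omega>) = power_product m N \<omega>"
  unfolding power_product_def by (rule power_product_hermitian[OF trunc_matrix_carrier])

lemma power_product_pow:
  "power_product m N \<omega> ^\<^sub>m k = word_mat (trunc_matrix N \<omega>) (concat (replicate k (replicate m True @ replicate m False)))"
  unfolding power_product_def by (rule power_product_word_mat[OF trunc_matrix_carrier])

lemma integrable_Re_trace: "integrable M (\<lambda>\<omega>. Re (mat_trace (power_product m N \<omega> ^\<^sub>m k)))"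
  unfolding power_product_pow by (rule integrable_Re[OF integrable_mat_trace])

lemma integrable_spectral_mean_poly: "integrable M (\<lambda>\<omega>. spectral_mean (power_product m N \<omega>) (poly p))"
  unfolding spectral_mean_poly[OF power_product_carrier power_product_adjoint]
  by (intro Bochner_Integration.integrable_sum integrable_mult_right integrable_divide integrable_Re_trace)

lemma spectral_mean_poly_limit:
  assumes m: "m \<ge> 1"
  shows "(\<lambda>N. \<integral>\<omega>. spectral_mean (power_product m N \<omega>) (poly p) \<partial>M)
    \<longlonglongrightarrow> (\<Sum>k\<le>degree p. coeff p k * fuss_catalan m k)"
proof -
  let ?w = "\<lambda>k. concat (replicate k (replicate m True @ replicate m False))"
  let ?t = "\<lambda>N k. \<integral>\<omega>. mat_trace (word_mat (trunc_matrix N \<omega>) (?w k)) \<partial>M"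
  have eq: "(\<integral>\<omega>. spectral_mean (power_product m N \<omega>) (poly p) \<partial>M)
      = (\<Sum>k\<le>degree p. coeff p k * Re (?t N k / complex_of_real (real N)))" for N
  proof -
    have "(\<integral>\<omega>. Re (mat_trace (power_product m N \<omega> ^\<^sub>m k)) \<partial>M) = Re (?t N k)" for k
      unfolding power_product_pow by (rule integral_Re[OF integrable_mat_trace])
    thus ?thesis
      unfolding spectral_mean_poly[OF power_product_carrier power_product_adjoint]
      by (subst Bochner_Integration.integral_sum) (auto intro!: integrable_Re_trace)
  qed
  have lim: "(\<lambda>N. Re (?t N k / complex_of_real (real N))) \<longlonglongrightarrow> fuss_catalan m k" for k
  proof -
    have "length (?w k) = 2 * (m * k)" by (simp add: length_concat sum_list_replicate)
    from tendsto_Re[OF expectation_mat_trace_limit[OF this]] show ?thesis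
      using pairings_block_word[of m k] m by simp
  qed
  show ?thesis unfolding eq by (intro tendsto_sum tendsto_mult tendsto_const lim)
qed

lemma power_product_cdf_trunc:
  "power_product_cdf m (trunc_matrix N \<omega>) t = spectral_mean (power_product m N \<omega>) (\<lambda>y. of_bool (y \<le> t))"
  by (simp add: power_product_cdf_def eigenvalue_cdf_spectral_mean power_product_def)

lemma integrable_power_product_cdf:
  assumes "\<And>i j. i \<ge> 1 \<Longrightarrow> j \<ge> 1 \<Longrightarrow> y i j \<in> borel_measurable M"
  shows "integrable M (\<lambda>\<omega>. power_product_cdf m (scaled_matrix (\<lambda>i j. y i j \<omega>) N) t)"
proof (rule integrable_const_bound)
  show "AE \<omega> in M. norm (power_product_cdf m (scaled_matrix (\<lambda>i j. y i j \<omega>) N) t) \<le> 1"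
    using power_product_cdf_bounds[OF scaled_matrix_carrier] by auto
  show "(\<lambda>\<omega>. power_product_cdf m (scaled_matrix (\<lambda>i j. y i j \<omega>) N) t) \<in> borel_measurable M"
    by (rule power_product_cdf_measurable[OF scaled_matrix_carrier])
       (use assms in \<open>simp add: scaled_matrix_index\<close>)
qed

lemma integrable_power_product_cdf_trunc: "integrable M (\<lambda>\<omega>. power_product_cdf m (trunc_matrix N \<omega>) t)"
  unfolding trunc_matrix_def
  by (rule integrable_power_product_cdf) (rule measurable_compose[OF xs_meas trunc_meas])

text \<open>Expected spectral means are monotone in the test function. The polynomials depend on
  \<open>e\<close> but not on N, so their convergence squeezes the indicator; the absence of atoms
  makes every \<open>t\<close> a continuity point.\<close>

lemma power_product_cdf_trunc_limit:
  assumes m: "m \<ge> 1"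
  shows "(\<lambda>N. \<integral>\<omega>. power_product_cdf m (trunc_matrix N \<omega>) t \<partial>M) \<longlonglongrightarrow> fuss_catalan_cdf m t"
proof -
  obtain G K where K: "K > 0" and G: "moment_model (fuss_catalan m) K G"
    using moment_model_fuss_catalan[OF m] by blast
  interpret G: real_distribution G using G by (simp add: moment_model_def)
  have cdf: "fuss_catalan_cdf m = cdf G"
    unfolding fuss_catalan_cdf_def fuss_catalan_measure_eq[OF G K] ..
  let ?L = "\<lambda>N f. \<integral>\<omega>. spectral_mean (power_product m N \<omega>) f \<partial>M"
  have lim: "(\<lambda>N. ?L N (poly p)) \<longlonglongrightarrow> (\<integral>y. poly p y \<partial>G)" for p
  proof -
    have "has_bochner_integral G (poly p) (\<Sum>k\<le>degree p. coeff p k * fuss_catalan m k)"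
      using G by (intro has_bochner_integral_poly) (simp add: moment_model_def)
    thus ?thesis using spectral_mean_poly_limit[OF m, of p] by (simp add: has_bochner_integral_iff)
  qed
  have int: "integrable M (\<lambda>\<omega>. spectral_mean (power_product m N \<omega>) (\<lambda>y. of_bool (y \<le> t)))" for N
    using integrable_power_product_cdf_trunc[of m N t] unfolding power_product_cdf_trunc .
  have "(\<lambda>N. ?L N (\<lambda>y. of_bool (y \<le> t))) \<longlonglongrightarrow> cdf G t"
  proof (rule LIMSEQ_I)
    fix e :: real assume e: "e > 0"
    have "isCont (cdf G) t" using moment_model_atomless[OF G] G.isCont_cdf by simp
    moreover have "e / 2 > 0" using e by simp
    moreover have "AE y in G. \<bar>y\<bar> \<le> K" using G by (simp add: moment_model_def)
    ultimately obtain p q where pq: "\<And>y. poly p y \<le> of_bool (y \<le> t)" "\<And>y. of_bool (y \<le> t) \<le> poly q y"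
      "cdf G t - e / 2 \<le> (\<integral>y. poly p y \<partial>G)" "(\<integral>y. poly q y \<partial>G) \<le> cdf G t + e / 2"
      using G.poly_sandwich_of_bool_le[OF K] by metis
    have "cdf G t - e < (\<integral>y. poly p y \<partial>G)" "(\<integral>y. poly q y \<partial>G) < cdf G t + e" using pq(3,4) e by linarith+
    hence "eventually (\<lambda>N. cdf G t - e < ?L N (poly p)) sequentially"
      "eventually (\<lambda>N. ?L N (poly q) < cdf G t + e) sequentially"
      using order_tendstoD(1)[OF lim] order_tendstoD(2)[OF lim] by blast+
    hence "eventually (\<lambda>N. norm (?L N (\<lambda>y. of_bool (y \<le> t)) - cdf G t) < e) sequentially"
    proof eventually_elim
      case (elim N)
      have "?L N (poly p) \<le> ?L N (\<lambda>y. of_bool (y \<le> t))" "?L N (\<lambda>y. of_bool (y \<le> t)) \<le> ?L N (poly q)"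
        by (intro integral_mono integrable_spectral_mean_poly int spectral_mean_mono pq)+
      thus ?case using elim by (simp add: abs_less_iff)
    qed
    thus "\<exists>no. \<forall>n\<ge>no. norm (?L n (\<lambda>y. of_bool (y \<le> t)) - cdf G t) < e"
      by (simp add: eventually_sequentially)
  qed
  thus ?thesis unfolding power_product_cdf_trunc cdf .
qed

section \<open>Removing the truncation\<close>

lemma tail_limit: "(\<lambda>N. (real N)\<^sup>2 * (\<integral>\<omega>. of_bool (cmod (x \<omega>) > sqrt (real N)) \<partial>M)) \<longlonglongrightarrow> 0"
proof (rule tendsto_sandwich[OF _ _ tendsto_const])
  \<comment> \<open>Markov's inequality with the indicator kept next to the fourth power: dominated
    convergence then gives o(1), where the bare moment would give only a bounded quantity.\<close>
  let ?f = "\<lambda>N \<omega>. cmod (x \<omega>) ^ 4 * of_bool (cmod (x \<omega>) > sqrt (real N))"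
  have "(\<lambda>N. \<integral>\<omega>. ?f N \<omega> \<partial>M) \<longlonglongrightarrow> (\<integral>\<omega>. 0 \<partial>M)"
  proof (rule integral_dominated_convergence)
    show "AE \<omega> in M. (\<lambda>N. ?f N \<omega>) \<longlonglongrightarrow> 0"
    proof (rule AE_I2, rule tendsto_eventually)
      fix \<omega>
      have "eventually (\<lambda>N. cmod (x \<omega>) \<le> sqrt (real N)) sequentially" by real_asymp
      thus "eventually (\<lambda>N. ?f N \<omega> = 0) sequentially" by eventually_elim simp
    qed
  qed (use x_int4 in auto)
  thus "(\<lambda>N. \<integral>\<omega>. ?f N \<omega> \<partial>M) \<longlonglongrightarrow> 0" by simp
  show "eventually (\<lambda>N. (real N)\<^sup>2 * (\<integral>\<omega>. of_bool (cmod (x \<omega>) > sqrt (real N)) \<partial>M) \<le> (\<integral>\<omega>. ?f N \<omega> \<partial>M)) sequentially"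
  proof (rule always_eventually, rule allI)
    fix N
    have "(real N)\<^sup>2 * (\<integral>\<omega>. of_bool (cmod (x \<omega>) > sqrt (real N)) \<partial>M)
        = (\<integral>\<omega>. (real N)\<^sup>2 * of_bool (cmod (x \<omega>) > sqrt (real N)) \<partial>M)" by simp
    also have "\<dots> \<le> (\<integral>\<omega>. ?f N \<omega> \<partial>M)"
    proof (rule integral_mono)
      show "integrable M (\<lambda>\<omega>. (real N)\<^sup>2 * of_bool (cmod (x \<omega>) > sqrt (real N)))"
        by (rule integrable_const_bound[of _ "(real N)\<^sup>2"]) auto
      show "integrable M (?f N)"
        by (rule Bochner_Integration.integrable_bound[OF x_int4]) auto
      show "(real N)\<^sup>2 * of_bool (cmod (x \<omega>) > sqrt (real N)) \<le> ?f N \<omega>" for \<omega>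
      proof (cases "cmod (x \<omega>) > sqrt (real N)")
        case True
        hence "sqrt (real N) ^ 4 \<le> cmod (x \<omega>) ^ 4" by (intro power_mono) auto
        moreover have "sqrt (real N) ^ 4 = (real N)\<^sup>2"
          using power_mult[of "sqrt (real N)" 2 2] by simp
        ultimately show ?thesis using True by simp
      qed simp
    qed
    finally show "(real N)\<^sup>2 * (\<integral>\<omega>. of_bool (cmod (x \<omega>) > sqrt (real N)) \<partial>M) \<le> (\<integral>\<omega>. ?f N \<omega> \<partial>M)" .
  qed
qed (auto intro!: always_eventually mult_nonneg_nonneg integral_nonneg)

text \<open>Both distribution functions lie in [0, 1] and agree unless one of the N^2 entries was
  truncated, so a union bound suffices.\<close>

lemma truncation_error:
  "\<bar>(\<integral>\<omega>. power_product_cdf m (scaled_matrix (\<lambda>i j. xs i j \<omega>) N) t \<partial>M)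
     - (\<integral>\<omega>. power_product_cdf m (trunc_matrix N \<omega>) t \<partial>M)\<bar>
   \<le> (real N)\<^sup>2 * (\<integral>\<omega>. of_bool (cmod (x \<omega>) > sqrt (real N)) \<partial>M)"
proof -
  let ?F = "\<lambda>\<omega>. power_product_cdf m (scaled_matrix (\<lambda>i j. xs i j \<omega>) N) t"
  let ?G = "\<lambda>\<omega>. power_product_cdf m (trunc_matrix N \<omega>) t"
  let ?b = "\<lambda>i j \<omega>. of_bool (cmod (xs i j \<omega>) > sqrt (real N)) :: real"
  have F: "integrable M ?F" by (intro integrable_power_product_cdf xs_meas)
  have G: "integrable M ?G" by (rule integrable_power_product_cdf_trunc)
  have b_int: "integrable M (?b i j)" if "i \<in> {1..N}" "j \<in> {1..N}" for i j
  proof (rule integrable_const_bound[of _ 1])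
    have [measurable]: "xs i j \<in> borel_measurable M" using that by (intro xs_meas) auto
    show "?b i j \<in> borel_measurable M" by measurable
  qed auto
  have "norm (\<integral>\<omega>. ?F \<omega> - ?G \<omega> \<partial>M) \<le> (\<integral>\<omega>. (\<Sum>i=1..N. \<Sum>j=1..N. ?b i j \<omega>) \<partial>M)"
  proof (rule norm_integral_le_integral)
    show "integrable M (\<lambda>\<omega>. ?F \<omega> - ?G \<omega>)" using F G by simp
    show "integrable M (\<lambda>\<omega>. \<Sum>i=1..N. \<Sum>j=1..N. ?b i j \<omega>)"
      by (intro Bochner_Integration.integrable_sum b_int)
    fix \<omega>
    show "norm (?F \<omega> - ?G \<omega>) \<le> (\<Sum>i=1..N. \<Sum>j=1..N. ?b i j \<omega>)"
    proof (cases "\<exists>i\<in>{1..N}. \<exists>j\<in>{1..N}. cmod (xs i j \<omega>) > sqrt (real N)")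
      case False
      have "scaled_matrix (\<lambda>i j. xs i j \<omega>) N = trunc_matrix N \<omega>"
        unfolding trunc_matrix_def using False
        by (intro scaled_matrix_cong) (auto simp: trunc_def not_less)
      thus ?thesis by (auto intro!: sum_nonneg)
    next
      case True
      then obtain i j where ij: "i \<in> {1..N}" "j \<in> {1..N}" "cmod (xs i j \<omega>) > sqrt (real N)" by blast
      have "norm (?F \<omega> - ?G \<omega>) \<le> 1"
        using power_product_cdf_bounds[OF scaled_matrix_carrier, of m "\<lambda>i j. xs i j \<omega>" N t]
          power_product_cdf_bounds[OF trunc_matrix_carrier, of m N \<omega> t] by (simp add: abs_le_iff)
      also have "1 = ?b i j \<omega>" using ij by simp
      also have "\<dots> \<le> (\<Sum>j=1..N. ?b i j \<omega>)" using ij by (intro member_le_sum) auto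
      also have "\<dots> \<le> (\<Sum>i=1..N. \<Sum>j=1..N. ?b i j \<omega>)"
        using ij by (intro member_le_sum[of i _ "\<lambda>i. \<Sum>j=1..N. ?b i j \<omega>"] sum_nonneg) auto
      finally show ?thesis .
    qed
  qed
  also have "(\<integral>\<omega>. (\<Sum>i=1..N. \<Sum>j=1..N. ?b i j \<omega>) \<partial>M) = (\<Sum>i=1..N. \<Sum>j=1..N. \<integral>\<omega>. ?b i j \<omega> \<partial>M)"
    by (subst Bochner_Integration.integral_sum, intro Bochner_Integration.integrable_sum b_int, assumption+)
      (intro sum.cong refl Bochner_Integration.integral_sum b_int)
  also have "\<dots> = (\<Sum>i=1..N. \<Sum>j=1..N. \<integral>\<omega>. of_bool (cmod (x \<omega>) > sqrt (real N)) \<partial>M)"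
  proof (intro sum.cong refl)
    fix i j assume "i \<in> {1..N}" "j \<in> {1..N}"
    thus "(\<integral>\<omega>. ?b i j \<omega> \<partial>M) = (\<integral>\<omega>. of_bool (cmod (x \<omega>) > sqrt (real N)) \<partial>M)"
      by (intro integral_xs[of i j "\<lambda>z. of_bool (cmod z > sqrt (real N))"]) auto
  qed
  also have "\<dots> = (real N)\<^sup>2 * (\<integral>\<omega>. of_bool (cmod (x \<omega>) > sqrt (real N)) \<partial>M)"
    by (simp add: power2_eq_square)
  finally show ?thesis using F G by simp
qed

lemma power_product_cdf_limit:
  assumes "m \<ge> 1"
  shows "(\<lambda>N. \<integral>\<omega>. power_product_cdf m (scaled_matrix (\<lambda>i j. xs i j \<omega>) N) t \<partial>M)
    \<longlonglongrightarrow> fuss_catalan_cdf m t"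
proof -
  have "(\<lambda>N. (\<integral>\<omega>. power_product_cdf m (scaled_matrix (\<lambda>i j. xs i j \<omega>) N) t \<partial>M)
     - (\<integral>\<omega>. power_product_cdf m (trunc_matrix N \<omega>) t \<partial>M)) \<longlonglongrightarrow> 0"
    by (rule Lim_null_comparison[OF _ tail_limit]) (simp add: truncation_error)
  from tendsto_add[OF this power_product_cdf_trunc_limit[OF assms, of t]] show ?thesis by simp
qed

end

theorem corollary1p2:
  fixes M :: "'a measure" and m :: nat
    and x :: "'a \<Rightarrow> complex" and xs :: "nat \<Rightarrow> nat \<Rightarrow> 'a \<Rightarrow> complex" and t :: real
  assumes "prob_space M"
    and "m \<ge> 1"
    and "x \<in> borel_measurable M"
    and "integrable M x" and "(\<integral>\<omega>. x \<omega> \<partial>M) = 0"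
    and "integrable M (\<lambda>\<omega>. (cmod (x \<omega>))\<^sup>2)" and "(\<integral>\<omega>. (cmod (x \<omega>))\<^sup>2 \<partial>M) = 1"
    and "integrable M (\<lambda>\<omega>. (cmod (x \<omega>)) ^ 4)"
    and "prob_space.indep_vars M (\<lambda>_. borel) (\<lambda>(i, j). xs i j) ({1..} \<times> {1..})"
    and "\<And>i j. i \<ge> 1 \<Longrightarrow> j \<ge> 1 \<Longrightarrow> distr M borel (xs i j) = distr M borel x"
  shows "(\<lambda>N. \<integral>\<omega>. power_product_cdf m (scaled_matrix (\<lambda>i j. xs i j \<omega>) N) t \<partial>M)
           \<longlonglongrightarrow> fuss_catalan_cdf m t"
proof -
  interpret iid_array M x xs
    using assms by (intro iid_array.intro iid_array_axioms.intro)
  show ?thesis by (rule power_product_cdf_limit[OF assms(2)])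
qed

end
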